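(* Let $\Gamma=(V,E)$ be a finite, undirected, weighted, connected graph with $N\ge 2$ vertices (loops allowed), and let $0=\lambda_0<\lambda_1\le\dots\le\lambda_{N-1}$ be the eigenvalues of its normalized Laplace operator. Then $$\frac{\overline{h}}{h}\le\frac{\lambda_{N-1}}{\lambda_1}\le\frac{\min\left[\min_{l\ \mathrm{even}}\left(1+(1-h[l]^2)^{\frac{1}{2l}}\right),\ \min_{l\ \mathrm{odd}}\left(1+(1-(1-\overline{h}[l])^2)^{\frac{1}{2l}}\right)\right]}{\max_{l}\left(1-(1-h[l]^2)^{\frac1{2l}}\right)},$$ where $l$ ranges over the positive integers (even, odd, and all, respectively), $h=h[1]$, $\overline{h}=\overline{h}[1]$, and $h[l]$, $\overline{h}[l]$ are the Cheeger constant and the dual Cheeger constant of the neighborhood graph $\Gamma[l]$.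
   Context: The weight function $w:V\times V\to\mathbb{R}$ satisfies $w_{ij}=w_{ji}$, $w_{ij}>0$ if $i\sim j$ (i.e. $i,j$ are joined by an edge; $i=j$ allowed, a loop) and $w_{ij}=0$ otherwise. The degree is $d_i=\sum_{j}w_{ij}$, and the normalized Laplace operator is $\Delta v(i)=\frac{1}{d_i}\sum_j w_{ij}(v(i)-v(j))$ for $v:V\to\mathbb{R}$. The neighborhood graph $\Gamma[l]$ is the weighted graph on the same vertex set $V$ with weights $w_{ij}[1]=w_{ij}$ and, for $l>1$, $$w_{ij}[l]=\sum_{k_1,\dots,k_{l-1}\in V}\frac{1}{d_{k_1}}\cdots\frac{1}{d_{k_{l-1}}}w_{ik_1}w_{k_1k_2}\cdots w_{k_{l-1}j},$$ and degrees $d_i[l]=\sum_jw_{ij}[l]$ (which equal $d_i$). Write $\mathrm{vol}(U)=\sum_{i\in U}d_i$ and $|E[l](U,W)|=\sum_{k\in U,m\in W}w_{km}[l]$. Then $$h[l]=\min_{U}\frac{|E[l](U,V\setminus U)|}{\min\{\mathrm{vol}(U),\mathrm{vol}(V\setminus U)\}}$$ over $U\subset V$ with $U$, $V\setminus U$ nonempty, and $$\overline{h}[l]=\max_{V_1,V_2}\frac{2|E[l](V_1,V_2)|}{\mathrm{vol}(V_1)+\mathrm{vol}(V_2)}$$ over disjoint nonempty $V_1,V_2\subseteq V$ (whose union need not be $V$). *)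

theory Defs
  imports "HOL-Analysis.Analysis" "HOL-Library.Multiset"
begin

text \<open>
  The vertex set is the universe of a finite type. The relation \<open>adj\<close> is the adjacency
  relation; \<open>adj i i\<close> is a loop at \<open>i\<close>.
\<close>

definition weighted_graph :: "('v \<Rightarrow> 'v \<Rightarrow> bool) \<Rightarrow> ('v \<Rightarrow> 'v \<Rightarrow> real) \<Rightarrow> bool" where
  "weighted_graph adj w \<longleftrightarrow>
     (\<forall>i j. adj i j \<longrightarrow> adj j i) \<and>
     (\<forall>i j. w i j = w j i) \<and>
     (\<forall>i j. adj i j \<longrightarrow> w i j > 0) \<and>
     (\<forall>i j. \<not> adj i j \<longrightarrow> w i j = 0)"

definition connected_graph :: "('v \<Rightarrow> 'v \<Rightarrow> bool) \<Rightarrow> bool" where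
  "connected_graph adj \<longleftrightarrow> (\<forall>i j. adj\<^sup>*\<^sup>* i j)"

definition deg :: "('v::finite \<Rightarrow> 'v \<Rightarrow> real) \<Rightarrow> 'v \<Rightarrow> real" where
  "deg w i = (\<Sum>j\<in>UNIV. w i j)"

definition vol :: "('v::finite \<Rightarrow> 'v \<Rightarrow> real) \<Rightarrow> 'v set \<Rightarrow> real" where
  "vol w U = (\<Sum>i\<in>U. deg w i)"

definition laplacian :: "('v::finite \<Rightarrow> 'v \<Rightarrow> real) \<Rightarrow> real ^ 'v \<Rightarrow> real ^ 'v" where
  "laplacian w v = (\<chi> i. 1 / deg w i * (\<Sum>j\<in>UNIV. w i j * (v $ i - v $ j)))"

definition eigenspace :: "('v::finite \<Rightarrow> 'v \<Rightarrow> real) \<Rightarrow> real \<Rightarrow> (real ^ 'v) set" where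
  "eigenspace w \<mu> = {v. laplacian w v = \<mu> *\<^sub>R v}"

text \<open>
  The eigenvalues in nondecreasing order, each repeated according to the dimension of its
  eigenspace. On a weighted graph with positive degrees the operator is self-adjoint for the
  inner product weighted by the degrees, so this list has exactly \<open>CARD('v)\<close> entries.
\<close>

definition laplacian_spectrum :: "('v::finite \<Rightarrow> 'v \<Rightarrow> real) \<Rightarrow> real list" where
  "laplacian_spectrum w =
     sorted_list_of_multiset
       (\<Sum>\<mu> | \<exists>v\<in>eigenspace w \<mu>. v \<noteq> 0. replicate_mset (dim (eigenspace w \<mu>)) \<mu>)"

definition laplacian_eigenvalue :: "('v::finite \<Rightarrow> 'v \<Rightarrow> real) \<Rightarrow> nat \<Rightarrow> real" where
  "laplacian_eigenvalue w k = laplacian_spectrum w ! k"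

text \<open>
  The list \<open>ks\<close> is \<open>k\<^sub>1, \<dots>, k\<^bsub>l-1\<^esub>\<close>. For \<open>l = 1\<close> only the empty list contributes and the sum is
  \<open>w i j\<close>. Only \<open>l \<ge> 1\<close> is meaningful.
\<close>

definition neighborhood_weight ::
    "('v::finite \<Rightarrow> 'v \<Rightarrow> real) \<Rightarrow> nat \<Rightarrow> 'v \<Rightarrow> 'v \<Rightarrow> real" where
  "neighborhood_weight w l i j =
     (\<Sum>ks | length ks = l - 1.
        (\<Prod>k\<leftarrow>ks. 1 / deg w k) *
        (\<Prod>t<l. w ((i # ks @ [j]) ! t) ((i # ks @ [j]) ! Suc t)))"

definition edge_weight ::
    "('v::finite \<Rightarrow> 'v \<Rightarrow> real) \<Rightarrow> nat \<Rightarrow> 'v set \<Rightarrow> 'v set \<Rightarrow> real" where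
  "edge_weight w l U W = (\<Sum>k\<in>U. \<Sum>m\<in>W. neighborhood_weight w l k m)"

text \<open>
  The volumes below are those of the original graph; the neighborhood graphs have the same
  degrees.
\<close>

definition cheeger :: "('v::finite \<Rightarrow> 'v \<Rightarrow> real) \<Rightarrow> nat \<Rightarrow> real" where
  "cheeger w l =
     Min ((\<lambda>U. edge_weight w l U (- U) / min (vol w U) (vol w (- U))) `
          {U. U \<noteq> {} \<and> - U \<noteq> {}})"

definition dual_cheeger :: "('v::finite \<Rightarrow> 'v \<Rightarrow> real) \<Rightarrow> nat \<Rightarrow> real" where
  "dual_cheeger w l =
     Max ((\<lambda>(V1, V2). 2 * edge_weight w l V1 V2 / (vol w V1 + vol w V2)) `
          {(V1, V2). V1 \<noteq> {} \<and> V2 \<noteq> {} \<and> V1 \<inter> V2 = {}})"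

text \<open>
  Minimum and maximum over the infinitely many \<open>l\<close>: the constants \<open>Min\<close> and \<open>Max\<close> only apply
  to finite sets, and \<open>Inf\<close> and \<open>Sup\<close> would not assert that the extremum is attained.
\<close>

definition even_upper_bound :: "('v::finite \<Rightarrow> 'v \<Rightarrow> real) \<Rightarrow> real" where
  "even_upper_bound w =
     (LEAST x. \<exists>l>0. even l \<and> x = 1 + (1 - (cheeger w l)\<^sup>2) powr (1 / (2 * real l)))"

definition odd_upper_bound :: "('v::finite \<Rightarrow> 'v \<Rightarrow> real) \<Rightarrow> real" where
  "odd_upper_bound w =
     (LEAST x. \<exists>l>0. odd l \<and> x = 1 + (1 - (1 - dual_cheeger w l)\<^sup>2) powr (1 / (2 * real l)))"

definition lower_bound :: "('v::finite \<Rightarrow> 'v \<Rightarrow> real) \<Rightarrow> real" where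
  "lower_bound w =
     (GREATEST x. \<exists>l>0. x = 1 - (1 - (cheeger w l)\<^sup>2) powr (1 / (2 * real l)))"

end

theory Submission
  imports Defs
begin

text \<open>
  Let \<open>P\<close> be the random walk operator, so that the Laplacian is \<open>1 - P\<close> and the Laplacian of
  \<open>\<Gamma>[l]\<close> is \<open>1 - P\<^sup>l\<close>. The left inequality follows from \<open>2 h\<^sup>- \<le> \<lambda>\<^bsub>N-1\<^esub>\<close> and \<open>\<lambda>\<^sub>1 \<le> 2 h\<close> (writing \<open>h\<^sup>-\<close> for
  the dual constant), obtained by inserting indicator-like functions into the Rayleigh quotient.
  For the right inequality one applies the sharp Cheeger and dual Cheeger inequalities
  \<open>h\<^sup>2 \<le> 1 - \<mu>\<^sup>2\<close> and \<open>(1 - h\<^sup>-)\<^sup>2 \<le> 1 - \<mu>\<^sup>2\<close> in \<open>\<Gamma>[l]\<close> to the eigenvalue \<open>\<mu> = (1 - \<lambda>)\<^sup>l\<close> of \<open>P\<^sup>l\<close>.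

  The extrema over \<open>l\<close> are attained: if \<open>\<kappa>\<^sub>l \<in> [0, 1]\<close> takes the value 1, the root
  \<open>(1 - \<kappa>\<^sub>l\<^sup>2)\<^bsup>1/(2l)\<^esup>\<close> takes its least possible value 0 there; if \<open>\<kappa>\<^sub>l\<close> stays away from 1, the
  root tends to 1, its largest possible value. That one of the two happens follows from the
  lower bound \<open>d\<^sub>i / vol V\<close> on the return probabilities after an even number of steps, itself
  an instance of the Cauchy-Schwarz inequality.
\<close>

section \<open>Self-adjoint operators\<close>

text \<open>The Rayleigh quotient attains its maximum \<open>m\<close> on the compact unit sphere of
  \<open>S\<close>. A nonzero residual \<open>m *\<^sub>R x - T x\<close> at a maximizer would give
  a direction along which the quotient could still be raised.\<close>

lemma selfadjoint_maximal_eigenvector: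
  fixes T :: "'a::euclidean_space \<Rightarrow> 'a"
  assumes T: "linear T" "\<And>x y. T x \<bullet> y = x \<bullet> T y"
    and S: "subspace S" "T ` S \<subseteq> S" "S \<noteq> {0}"
  obtains x m where "x \<in> S" "norm x = 1" "T x = m *\<^sub>R x" "\<And>y. y \<in> S \<Longrightarrow> T y \<bullet> y \<le> m * (y \<bullet> y)"
proof -
  interpret T: linear T by (fact T)
  let ?K = "S \<inter> sphere 0 1"
  obtain z where z: "z \<in> S" "z \<noteq> 0"
    using S subspace_0 by blast
  have "z /\<^sub>R norm z \<in> ?K"
    using z S by (simp add: subspace_scale)
  moreover have "compact ?K"
    using S by (simp add: closed_Int_compact closed_subspace)
  moreover have "continuous_on ?K (\<lambda>x. T x \<bullet> x)"
    using T(1) by (intro continuous_intros linear_continuous_on linear_conv_bounded_linear[THEN iffD1])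
  ultimately obtain x where x: "x \<in> ?K" and max: "\<And>y. y \<in> ?K \<Longrightarrow> T y \<bullet> y \<le> T x \<bullet> x"
    using continuous_attains_sup[of ?K "\<lambda>x. T x \<bullet> x"] by blast
  define m where "m = T x \<bullet> x"
  have xS: "x \<in> S" "norm x = 1" "x \<bullet> x = 1" using x by (auto simp: dot_square_norm)
  have le: "T y \<bullet> y \<le> m * (y \<bullet> y)" if y: "y \<in> S" for y
  proof (cases "y = 0")
    case False
    have "T (y /\<^sub>R norm y) \<bullet> (y /\<^sub>R norm y) \<le> m"
      unfolding m_def using y False S by (intro max) (simp add: subspace_scale)
    then have "(T y \<bullet> y) / (norm y * norm y) \<le> m"
      by (simp add: T.scale field_simps)
    then show ?thesis
      using False by (simp add: pos_divide_le_eq dot_square_norm power2_eq_square)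
  qed (simp add: T.zero)
  define y where "y = m *\<^sub>R x - T x"
  have yS: "y \<in> S" unfolding y_def using S xS by (intro subspace_diff subspace_scale) auto
  define b where "b = m * (y \<bullet> y) - T y \<bullet> y"
  have b: "b \<ge> 0" using le[OF yS] by (simp add: b_def)
  have Tyx: "T y \<bullet> x = T x \<bullet> y" by (metis T(2) inner_commute)
  \<comment> \<open>The form \<open>m * (z \<bullet> z) - T z \<bullet> z\<close> is nonnegative on
    \<open>S\<close> and vanishes at \<open>x\<close>; expanded at \<open>x - t *\<^sub>R y\<close>
    it leaves only a linear and a quadratic term in \<open>t\<close>.\<close>
  have quad: "2 * t * (y \<bullet> y) \<le> t\<^sup>2 * b" for t
  proof -
    have "x - t *\<^sub>R y \<in> S" using S xS yS by (intro subspace_diff subspace_scale)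
    from le[OF this] have "0 \<le> m * ((x - t *\<^sub>R y) \<bullet> (x - t *\<^sub>R y)) - T (x - t *\<^sub>R y) \<bullet> (x - t *\<^sub>R y)"
      by simp
    also have "\<dots> = m * (x \<bullet> x) - T x \<bullet> x - 2 * t * (m * (x \<bullet> y) - T x \<bullet> y) + t\<^sup>2 * b"
      unfolding b_def T.diff T.scale inner_diff_left inner_diff_right
      by (simp add: Tyx inner_commute[of y x] algebra_simps power2_eq_square)
    also have "m * (x \<bullet> y) - T x \<bullet> y = y \<bullet> y"
      by (simp add: y_def inner_diff_left inner_diff_right inner_commute[of "T x" x])
    finally show ?thesis using xS by (simp add: m_def)
  qed
  have "y = 0"
  proof (rule ccontr)
    assume "y \<noteq> 0"
    \<comment> \<open>For small positive \<open>t\<close> the linear term dominates;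
      \<open>b + 1\<close> instead of \<open>b\<close> avoids a zero denominator.\<close>
    define t where "t = (y \<bullet> y) / (b + 1)"
    have t: "t > 0" using \<open>y \<noteq> 0\<close> b by (simp add: t_def)
    have "t * b < 2 * (y \<bullet> y)"
      using \<open>y \<noteq> 0\<close> b unfolding t_def by (simp add: field_simps add_nonneg_pos)
    then have "t * (t * b) < t * (2 * (y \<bullet> y))" using t by simp
    then show False using quad[of t] by (simp add: power2_eq_square algebra_simps)
  qed
  then have "T x = m *\<^sub>R x" by (simp add: y_def)
  with xS le show thesis by (intro that)
qed

text \<open>Induction on the dimension: split off one eigenvector and continue in its orthogonal
  complement within \<open>S\<close>, which self-adjointness makes invariant under
  \<open>T\<close>.\<close>

lemma selfadjoint_eigenbasis_subspace:
  fixes T :: "'a::euclidean_space \<Rightarrow> 'a"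
  assumes T: "linear T" "\<And>x y. T x \<bullet> y = x \<bullet> T y"
    and "subspace S" "T ` S \<subseteq> S"
  shows "\<exists>B e. B \<subseteq> S \<and> span B = S \<and> pairwise orthogonal B \<and> 0 \<notin> B \<and> (\<forall>b\<in>B. T b = e b *\<^sub>R b)"
  using assms(3,4)
proof (induction "dim S" arbitrary: S rule: less_induct)
  case less
  interpret T: linear T by (fact T)
  show ?case
  proof (cases "S = {0}")
    case True
    then show ?thesis by (intro exI[of _ "{}"]) auto
  next
    case False
    obtain x m where x: "x \<in> S" "norm x = 1" "T x = m *\<^sub>R x"
      using selfadjoint_maximal_eigenvector[OF T less.prems False] by blast
    define S' where "S' = {y \<in> S. x \<bullet> y = 0}"
    have xx: "x \<bullet> x = 1" using x by (simp add: dot_square_norm)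
    have sub: "subspace S'"
      using less.prems by (auto simp: S'_def subspace_def inner_right_distrib)
    have inv: "T ` S' \<subseteq> S'"
      using less.prems x by (auto simp: S'_def T(2)[symmetric])
    have "x \<notin> S'" by (simp add: S'_def xx)
    moreover have "S' \<subseteq> S" by (auto simp: S'_def)
    ultimately have "S' \<subset> S" using x by blast
    then have "dim S' < dim S"
      using sub less.prems by (intro dim_psubset) (simp add: span_eq_iff[THEN iffD2])
    from less.hyps[OF this sub inv] obtain B e where
      B: "B \<subseteq> S'" "span B = S'" "pairwise orthogonal B" "0 \<notin> B" "\<forall>b\<in>B. T b = e b *\<^sub>R b"
      by blast
    have xB: "x \<notin> B" using B xx by (auto simp: S'_def)
    have "y \<in> span (insert x B)" if "y \<in> S" for y
    proof -
      have "y - (x \<bullet> y) *\<^sub>R x \<in> S'"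
        using that less.prems x xx
        by (auto simp: S'_def inner_diff_right intro!: subspace_diff subspace_scale)
      then show ?thesis using B by (auto simp: span_breakdown_eq)
    qed
    moreover have "span (insert x B) \<subseteq> S"
      using B x less.prems by (intro span_minimal) (auto simp: S'_def)
    ultimately have "span (insert x B) = S" by blast
    moreover have "pairwise orthogonal (insert x B)"
      using B by (auto simp: pairwise_insert orthogonal_def S'_def inner_commute)
    moreover have "insert x B \<subseteq> S" using B x by (auto simp: S'_def)
    moreover have "0 \<notin> insert x B" using B x by auto
    moreover have "\<forall>b\<in>insert x B. T b = (e(x := m)) b *\<^sub>R b" using B x xB by auto
    ultimately show ?thesis by blast
  qed
qed

text \<open>In an orthogonal eigenbasis each eigenspace is spanned by the basis vectors carrying its
  eigenvalue, so the dimensions add up to the size of the basis.\<close>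

lemma selfadjoint_sum_dim_eigenspaces:
  fixes T :: "'a::euclidean_space \<Rightarrow> 'a"
  assumes T: "linear T" "\<And>x y. T x \<bullet> y = x \<bullet> T y"
  defines "E \<equiv> \<lambda>\<mu>. {v. T v = \<mu> *\<^sub>R v}"
  shows "finite {\<mu>. \<exists>v\<in>E \<mu>. v \<noteq> 0}"
    and "(\<Sum>\<mu> | \<exists>v\<in>E \<mu>. v \<noteq> 0. dim (E \<mu>)) = DIM('a)"
proof -
  interpret T: linear T by (fact T)
  obtain B e where B: "span B = UNIV" "pairwise orthogonal B" "0 \<notin> B" "\<And>b. b \<in> B \<Longrightarrow> T b = e b *\<^sub>R b"
    using selfadjoint_eigenbasis_subspace[OF T, of UNIV] by auto
  have ind: "independent B" using B pairwise_orthogonal_independent by blast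
  have fin: "finite B" using ind independent_imp_finite by blast
  have E: "E \<mu> = span {b \<in> B. e b = \<mu>}" for \<mu>
  proof
    have "subspace (E \<mu>)"
      by (auto simp: E_def subspace_def T.zero T.add T.scale algebra_simps)
    then show "span {b \<in> B. e b = \<mu>} \<subseteq> E \<mu>"
      using B by (intro span_minimal) (auto simp: E_def)
    show "E \<mu> \<subseteq> span {b \<in> B. e b = \<mu>}"
    proof
      fix v assume v: "v \<in> E \<mu>"
      have "v \<in> span B" using B by simp
      then obtain c where c: "v = (\<Sum>b\<in>B. c b *\<^sub>R b)" using fin span_finite by blast
      \<comment> \<open>Pairing with \<open>b\<close> isolates \<open>c b\<close>, and moving
        \<open>T\<close> across the inner product yields
        \<open>\<mu> * (v \<bullet> b) = e b * (v \<bullet> b)\<close>.\<close>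
      have 0: "c b = 0" if b: "b \<in> B" "e b \<noteq> \<mu>" for b
      proof -
        have "v \<bullet> b = (\<Sum>b'\<in>B. c b' * (b' \<bullet> b))" by (simp add: c inner_sum_left)
        also have "\<dots> = (\<Sum>b'\<in>{b}. c b' * (b' \<bullet> b))"
          using B b fin by (intro sum.mono_neutral_right) (auto simp: pairwise_def orthogonal_def)
        finally have vb: "v \<bullet> b = c b * (b \<bullet> b)" by simp
        have "\<mu> * (v \<bullet> b) = T v \<bullet> b" using v by (simp add: E_def)
        also have "\<dots> = e b * (v \<bullet> b)" using B b by (simp add: T(2))
        finally have "v \<bullet> b = 0" using b by simp
        then show ?thesis using vb b B by auto
      qed
      show "v \<in> span {b \<in> B. e b = \<mu>}"
        unfolding c
      proof (rule span_sum)
        fix b assume "b \<in> B"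
        then show "c b *\<^sub>R b \<in> span {b \<in> B. e b = \<mu>}"
          using 0[of b] by (cases "e b = \<mu>") (auto intro: span_scale span_base span_zero)
      qed
    qed
  qed
  have dimE: "dim (E \<mu>) = card {b \<in> B. e b = \<mu>}" for \<mu>
    unfolding E by (simp add: dim_eq_card_independent independent_mono[OF ind])
  have set: "{\<mu>. \<exists>v\<in>E \<mu>. v \<noteq> 0} = e ` B"
  proof (intro set_eqI iffI)
    fix \<mu> assume "\<mu> \<in> {\<mu>. \<exists>v\<in>E \<mu>. v \<noteq> 0}"
    then have "{b \<in> B. e b = \<mu>} \<noteq> {}" using E by force
    then show "\<mu> \<in> e ` B" by auto
  next
    fix \<mu> assume "\<mu> \<in> e ` B"
    then show "\<mu> \<in> {\<mu>. \<exists>v\<in>E \<mu>. v \<noteq> 0}" using B by (auto simp: E_def)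
  qed
  show "finite {\<mu>. \<exists>v\<in>E \<mu>. v \<noteq> 0}" unfolding set using fin by simp
  have "(\<Sum>\<mu>\<in>e ` B. dim (E \<mu>)) = (\<Sum>\<mu>\<in>e ` B. \<Sum>b | b \<in> B \<and> e b = \<mu>. 1)"
    by (simp add: dimE)
  also have "\<dots> = card B" using sum.image_gen[OF fin, of "\<lambda>_. 1::nat" e] by simp
  also have "\<dots> = DIM('a)" using dim_eq_card_independent[OF ind] dim_span[of B] B by simp
  finally show "(\<Sum>\<mu> | \<exists>v\<in>E \<mu>. v \<noteq> 0. dim (E \<mu>)) = DIM('a)" unfolding set .
qed

section \<open>Attained extrema of roots\<close>

lemma le_powr_inverse:
  fixes x y :: real
  assumes "x ^ n \<le> y" "n > 0" "y \<ge> 0"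
  shows "x \<le> y powr (1 / real n)"
proof (cases "x > 0")
  case True
  have "x = (x ^ n) powr (1 / real n)"
    using True assms by (simp add: powr_powr flip: powr_realpow)
  also have "\<dots> \<le> y powr (1 / real n)"
    using True assms by (intro powr_mono2) auto
  finally show ?thesis .
next
  case False
  then show ?thesis using powr_ge_zero[of y "1 / real n"] by linarith
qed

text \<open>\<open>A\<close> stands for the even, the odd or all positive lengths, and
  \<open>\<kappa>\<close> for the Cheeger constant or one minus the dual one.\<close>

lemma least_root_attained:
  fixes \<kappa> :: "nat \<Rightarrow> real"
  defines "r \<equiv> \<lambda>l. (1 - (\<kappa> l)\<^sup>2) powr (1 / (2 * real l))"
  assumes A: "a \<in> A" "\<And>l. l \<in> A \<Longrightarrow> l > 0"
    and \<kappa>: "\<And>l. l \<in> A \<Longrightarrow> 0 \<le> \<kappa> l" "\<And>l. l \<in> A \<Longrightarrow> \<kappa> l \<le> 1"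
    and dich: "(\<exists>l\<in>A. \<kappa> l = 1) \<or> (\<exists>c<1. \<forall>l\<in>A. \<kappa> l \<le> c)"
  shows "\<exists>l\<in>A. \<forall>k\<in>A. r l \<le> r k"
  using dich
proof
  assume "\<exists>l\<in>A. \<kappa> l = 1"
  then obtain l where "l \<in> A" "\<kappa> l = 1" by blast
  \<comment> \<open>\<open>0 powr x\<close> is 0, the least value \<open>powr\<close> can
    take.\<close>
  then show ?thesis by (intro bexI[of _ l]) (auto simp: r_def)
next
  assume "\<exists>c<1. \<forall>l\<in>A. \<kappa> l \<le> c"
  then obtain c where c: "c < 1" "\<And>l. l \<in> A \<Longrightarrow> \<kappa> l \<le> c" by blast
  have c0: "0 \<le> c" using \<kappa>(1)[OF A(1)] c(2)[OF A(1)] by simp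
  have sq: "0 \<le> 1 - (\<kappa> l)\<^sup>2" "1 - (\<kappa> l)\<^sup>2 \<le> 1" "1 - c\<^sup>2 \<le> 1 - (\<kappa> l)\<^sup>2" if "l \<in> A" for l
    using \<kappa>[OF that] c(2)[OF that] by (auto simp: abs_square_le_1 power_mono)
  have le1: "r l \<le> 1" if "l \<in> A" for l
    unfolding r_def using sq[OF that] by (intro powr_le1) auto
  show ?thesis
  proof (cases "\<exists>b\<in>A. r b < 1")
    case False
    \<comment> \<open>Every root equals 1 in this case, so any index is a minimizer.\<close>
    then show ?thesis using A(1) le1 by (intro bexI[of _ a]) force+
  next
    case True
    then obtain b where b: "b \<in> A" "r b < 1" by blast
    have c2: "1 - c\<^sup>2 > 0" using c c0 by (simp add: abs_square_less_1)
    \<comment> \<open>This lower bound for the roots tends to 1, so past some \<open>L\<close> no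
      root is as small as \<open>r b\<close>, and finitely many candidates remain.\<close>
    have "(\<lambda>l. (1 - c\<^sup>2) powr (1 / (2 * real l))) \<longlonglongrightarrow> (1 - c\<^sup>2) powr 0"
    proof (intro tendsto_powr tendsto_const)
      have "(\<lambda>l. (1 / 2) * inverse (real l)) \<longlonglongrightarrow> (1 / 2) * 0"
        by (intro tendsto_mult tendsto_const lim_inverse_n)
      then show "(\<lambda>l. 1 / (2 * real l)) \<longlonglongrightarrow> 0" by (simp add: field_simps)
    qed (use c2 in simp)
    then have "eventually (\<lambda>l. r b < (1 - c\<^sup>2) powr (1 / (2 * real l))) sequentially"
      using b c2 by (intro order_tendstoD) auto
    then obtain L where L: "\<And>l. l \<ge> L \<Longrightarrow> r b < (1 - c\<^sup>2) powr (1 / (2 * real l))"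
      by (auto simp: eventually_sequentially)
    have tail: "r b < r l" if "l \<in> A" "l \<ge> L" for l
      using L[OF that(2)] powr_mono2[of "1 / (2 * real l)" "1 - c\<^sup>2" "1 - (\<kappa> l)\<^sup>2"] sq[OF that(1)] c2
      by (simp add: r_def)
    have "finite {l \<in> A. l < L}" "{l \<in> A. l < L} \<noteq> {}" using tail[of b] b by (auto intro: not_le_imp_less)
    then obtain l where l: "l \<in> A" "l < L" "\<And>k. k \<in> A \<Longrightarrow> k < L \<Longrightarrow> r l \<le> r k"
      using arg_min_if_finite[of "{l \<in> A. l < L}" r] arg_min_least[of "{l \<in> A. l < L}" _ r]
      by (metis (mono_tags, lifting) mem_Collect_eq)
    have "r l \<le> r b" using l b tail[of b] by (metis linorder_not_less order_less_irrefl)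
    then show ?thesis using l tail by (metis linorder_not_less order_less_imp_le order_trans)
  qed
qed

text \<open>Applied to the spectrum, where a simple zero eigenvalue in front makes entry 1 the least
  positive one.\<close>

lemma sorted_second:
  fixes xs :: "real list"
  assumes "sorted xs" "length xs \<ge> 2" "\<And>x. x \<in> set xs \<Longrightarrow> x \<ge> 0" "0 \<in> set xs" "count (mset xs) 0 \<le> 1"
  shows "xs ! 1 > 0" "\<And>x. x \<in> set xs \<Longrightarrow> x > 0 \<Longrightarrow> xs ! 1 \<le> x"
proof -
  obtain a b ys where xs: "xs = a # b # ys"
    using assms(2) by (cases xs; cases "tl xs") auto
  have a: "a = 0" using assms(1,3,4) unfolding xs by force
  then show "xs ! 1 > 0" using assms(1,3,5) unfolding xs by (cases "b = 0") force+
  show "xs ! 1 \<le> x" if "x \<in> set xs" "x > 0" for x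
    using that a assms(1) unfolding xs by auto
qed

section \<open>Cheeger and dual Cheeger inequalities\<close>

text \<open>Symmetry, nonnegativity and positive degrees pass to every neighborhood graph, even to a
  disconnected one, so each of them is an instance.\<close>

locale weight_matrix =
  fixes W :: "'v::finite \<Rightarrow> 'v \<Rightarrow> real"
  assumes sym: "W i j = W j i" and nonneg: "W i j \<ge> 0" and deg_pos: "deg W i > 0"
begin

definition cut :: "'v set \<Rightarrow> 'v set \<Rightarrow> real" where
  "cut U U' = (\<Sum>i\<in>U. \<Sum>j\<in>U'. W i j)"

definition sq_norm :: "('v \<Rightarrow> real) \<Rightarrow> real" where
  "sq_norm f = (\<Sum>i\<in>UNIV. deg W i * (f i)\<^sup>2)"

lemma cut_nonneg: "cut U U' \<ge> 0"
  by (simp add: cut_def nonneg sum_nonneg)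

lemma cut_commute: "cut U U' = cut U' U"
  unfolding cut_def by (subst sum.swap) (simp add: sym)

lemma vol_eq_cut: "vol W U = cut U UNIV"
  by (simp add: vol_def cut_def deg_def)

lemma cut_Un:
  assumes "U' \<inter> U'' = {}"
  shows "cut U (U' \<union> U'') = cut U U' + cut U U''"
  using assms by (simp add: cut_def sum.union_disjoint sum.distrib)

lemma vol_Un: "U \<inter> U' = {} \<Longrightarrow> vol W (U \<union> U') = vol W U + vol W U'"
  by (simp add: vol_def sum.union_disjoint)

lemma vol_pos: "U \<noteq> {} \<Longrightarrow> vol W U > 0"
  by (simp add: vol_def deg_pos sum_pos)

lemma vol_mono: "U \<subseteq> U' \<Longrightarrow> vol W U \<le> vol W U'"
  by (simp add: vol_def sum_mono2 deg_pos less_imp_le)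

lemma vol_split: "vol W U = cut U U + cut U (- U)"
  using cut_Un[of U "- U" U] by (simp add: vol_eq_cut)

lemma sq_norm_pos:
  assumes "f i \<noteq> 0"
  shows "sq_norm f > 0"
  unfolding sq_norm_def
  by (rule sum_pos2[of _ i]) (use assms deg_pos in \<open>auto simp: less_imp_le\<close>)

lemma cut_indicator: "(\<Sum>i\<in>UNIV. \<Sum>j\<in>UNIV. W i j * (indicator A i * indicator B j)) = cut A B"
proof -
  have "(\<Sum>j\<in>UNIV. W i j * (indicator A i * indicator B j)) = (\<Sum>j\<in>B. W i j) * indicator A i" for i
    by (simp add: indicator_def of_bool_def if_distrib[of "times _"] sum.If_cases cong: if_cong)
  then show ?thesis by (simp add: cut_def indicator_def of_bool_def if_distrib[of "times _"] sum.If_cases cong: if_cong)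
qed

lemma sum_fst: "(\<Sum>i\<in>UNIV. \<Sum>j\<in>UNIV. W i j * g i) = (\<Sum>i\<in>UNIV. deg W i * g i)"
  by (simp add: deg_def sum_distrib_right)

lemma sum_snd: "(\<Sum>i\<in>UNIV. \<Sum>j\<in>UNIV. W i j * g j) = (\<Sum>i\<in>UNIV. deg W i * g i)"
  by (subst sum.swap) (simp add: deg_def sum_distrib_right sym)

lemma sum_eigen_product:
  assumes "\<And>i. (\<Sum>j\<in>UNIV. W i j * f j) = \<mu> * deg W i * f i"
  shows "(\<Sum>i\<in>UNIV. \<Sum>j\<in>UNIV. W i j * (f i * f j)) = \<mu> * sq_norm f"
proof -
  have "(\<Sum>i\<in>UNIV. \<Sum>j\<in>UNIV. W i j * (f i * f j)) = (\<Sum>i\<in>UNIV. f i * (\<Sum>j\<in>UNIV. W i j * f j))"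
    by (simp add: sum_distrib_left mult_ac)
  also have "\<dots> = \<mu> * sq_norm f"
    unfolding assms by (simp add: sq_norm_def sum_distrib_left power2_eq_square mult_ac)
  finally show ?thesis .
qed

lemma sum_diff_squares:
  "(\<Sum>i\<in>UNIV. \<Sum>j\<in>UNIV. W i j * (f i - f j)\<^sup>2) =
     2 * sq_norm f - 2 * (\<Sum>i\<in>UNIV. \<Sum>j\<in>UNIV. W i j * (f i * f j))"
proof -
  have "(\<Sum>i\<in>UNIV. \<Sum>j\<in>UNIV. W i j * (f i - f j)\<^sup>2) =
    (\<Sum>i\<in>UNIV. \<Sum>j\<in>UNIV. W i j * (f i)\<^sup>2) + (\<Sum>i\<in>UNIV. \<Sum>j\<in>UNIV. W i j * (f j)\<^sup>2)
     - 2 * (\<Sum>i\<in>UNIV. \<Sum>j\<in>UNIV. W i j * (f i * f j))"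
    by (simp add: power2_diff algebra_simps sum.distrib sum_subtractf sum_distrib_left)
  then show ?thesis by (simp add: sum_fst sum_snd sq_norm_def)
qed

lemma sum_add_squares:
  "(\<Sum>i\<in>UNIV. \<Sum>j\<in>UNIV. W i j * (f i + f j)\<^sup>2) =
     2 * sq_norm f + 2 * (\<Sum>i\<in>UNIV. \<Sum>j\<in>UNIV. W i j * (f i * f j))"
proof -
  have "(\<Sum>i\<in>UNIV. \<Sum>j\<in>UNIV. W i j * (f i + f j)\<^sup>2) =
    (\<Sum>i\<in>UNIV. \<Sum>j\<in>UNIV. W i j * (f i)\<^sup>2) + (\<Sum>i\<in>UNIV. \<Sum>j\<in>UNIV. W i j * (f j)\<^sup>2)
     + 2 * (\<Sum>i\<in>UNIV. \<Sum>j\<in>UNIV. W i j * (f i * f j))"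
    by (simp add: power2_sum algebra_simps sum.distrib sum_subtractf sum_distrib_left)
  then show ?thesis by (simp add: sum_fst sum_snd sq_norm_def)
qed

text \<open>
  Both Cheeger inequalities are instances of one estimate. The relation \<open>R\<close> marks the edges on
  which the summand \<open>\<bar>\<phi> i - \<phi> j\<bar>\<close> is replaced by \<open>\<phi> i + \<phi> j\<close>: none for the Cheeger constant,
  those whose ends carry the same sign of the eigenfunction for the dual constant.
\<close>

definition variation :: "('v \<Rightarrow> 'v \<Rightarrow> bool) \<Rightarrow> ('v \<Rightarrow> real) \<Rightarrow> real" where
  "variation R \<phi> =
     (\<Sum>i\<in>UNIV. \<Sum>j\<in>UNIV. W i j * (if R i j then \<phi> i + \<phi> j else \<bar>\<phi> i - \<phi> j\<bar>)) / 2"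

text \<open>
  Layer-cake argument: with \<open>m\<close> the least positive value of \<open>\<phi>\<close> and \<open>S\<close> its support, the variation
  is additive on \<open>\<phi> = m 1\<^sub>S + \<psi>\<close>, and \<open>\<psi>\<close> has smaller support.
\<close>

lemma variation_ge:
  assumes "\<And>i. \<phi> i \<ge> 0"
    and "\<And>S. S \<noteq> {} \<Longrightarrow> S \<subseteq> {i. \<phi> i > 0} \<Longrightarrow> \<kappa> * vol W S \<le> variation R (indicator S)"
  shows "\<kappa> * (\<Sum>i\<in>UNIV. deg W i * \<phi> i) \<le> variation R \<phi>"
  using assms
proof (induction "card {i. \<phi> i > 0}" arbitrary: \<phi> rule: less_induct)
  case less
  define S where "S = {i. \<phi> i > 0}"
  show ?case
  proof (cases "S = {}")
    case True
    then have "\<phi> i = 0" for i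
      using less.prems(1)[of i] by (auto simp: S_def not_less order_antisym)
    then show ?thesis by (simp add: variation_def cong: if_cong)
  next
    case False
    define m where "m = Min (\<phi> ` S)"
    have "m \<in> \<phi> ` S" unfolding m_def using False by (intro Min_in) auto
    then obtain k where k: "k \<in> S" "\<phi> k = m" by auto
    have m: "m > 0" using k by (auto simp: S_def)
    have m_le: "m \<le> \<phi> i" if "i \<in> S" for i unfolding m_def using that by (intro Min_le) auto
    define \<psi> where "\<psi> i = \<phi> i - m * indicator S i" for i
    have out: "\<phi> i = 0" if "i \<notin> S" for i
      using that less.prems(1)[of i] by (auto simp: S_def)
    have \<psi>_nonneg: "\<psi> i \<ge> 0" for i
      using m_le[of i] out[of i] by (auto simp: \<psi>_def indicator_def)
    have "\<psi> i = 0" if "i \<notin> S" for i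
      using that by (simp add: \<psi>_def out)
    then have sub: "{i. \<psi> i > 0} \<subseteq> S" by force
    have "k \<notin> {i. \<psi> i > 0}" using k by (auto simp: \<psi>_def)
    then have "{i. \<psi> i > 0} \<subset> S" using sub k by auto
    then have "card {i. \<psi> i > 0} < card {i. \<phi> i > 0}"
      by (simp add: S_def psubset_card_mono)
    then have IH: "\<kappa> * (\<Sum>i\<in>UNIV. deg W i * \<psi> i) \<le> variation R \<psi>"
      using sub by (intro less.hyps \<psi>_nonneg less.prems) (auto simp: S_def)
    have base: "\<kappa> * vol W S \<le> variation R (indicator S)"
      using False by (intro less.prems) (auto simp: S_def)
    have split: "\<phi> i = m * indicator S i + \<psi> i" for i by (simp add: \<psi>_def)
    \<comment> \<open>Nothing cancels inside the absolute value: \<open>\<phi>\<close> is 0 off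
      \<open>S\<close> and at least \<open>m\<close> on it, so across the boundary of
      \<open>S\<close> both differences have the same sign, and within \<open>S\<close> the
      indicator difference is 0.\<close>
    have "(if R i j then \<phi> i + \<phi> j else \<bar>\<phi> i - \<phi> j\<bar>) =
        m * (if R i j then indicator S i + indicator S j else \<bar>indicator S i - indicator S j\<bar>) +
        (if R i j then \<psi> i + \<psi> j else \<bar>\<psi> i - \<psi> j\<bar>)" for i j
      using out[of i] out[of j] m_le[of i] m_le[of j] m
      by (cases "i \<in> S"; cases "j \<in> S") (auto simp: \<psi>_def algebra_simps)
    then have "variation R \<phi> = m * variation R (indicator S) + variation R \<psi>"
      by (simp add: variation_def algebra_simps sum.distrib sum_distrib_left add_divide_distrib)
    moreover have "(\<Sum>i\<in>UNIV. deg W i * \<phi> i) = m * vol W S + (\<Sum>i\<in>UNIV. deg W i * \<psi> i)"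
    proof -
      have "(\<Sum>i\<in>UNIV. deg W i * \<phi> i) = (\<Sum>i\<in>UNIV. deg W i * (m * indicator S i)) + (\<Sum>i\<in>UNIV. deg W i * \<psi> i)"
        by (subst split) (simp add: distrib_left sum.distrib)
      also have "(\<Sum>i\<in>UNIV. deg W i * (m * indicator S i)) = m * vol W S"
        by (simp only: mult.left_commute[of _ m] flip: sum_distrib_left) (simp add: vol_def)
      finally show ?thesis .
    qed
    moreover have "\<kappa> * (m * vol W S + X) = m * (\<kappa> * vol W S) + \<kappa> * X" for X
      by (simp add: algebra_simps)
    moreover have "m * (\<kappa> * vol W S) \<le> m * variation R (indicator S)"
      using base m by (intro mult_left_mono) auto
    ultimately show ?thesis using IH by simp
  qed
qed

text \<open>
  Write the summands of the variation of \<open>a\<^sup>2\<close> as \<open>p i j * q i j\<close> with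
  \<open>(p i j)\<^sup>2 + (q i j)\<^sup>2 = 2 (a i)\<^sup>2 + 2 (a j)\<^sup>2\<close>. This identity, instead of a crude bound on \<open>q\<close>,
  makes Cauchy-Schwarz give the constant \<open>1 - \<nu>\<^sup>2\<close>.
\<close>

lemma cheeger_estimate:
  assumes a: "\<And>i. a i \<ge> 0" "a k \<noteq> 0"
    and \<kappa>: "\<kappa> \<ge> 0"
      "\<And>S. S \<noteq> {} \<Longrightarrow> S \<subseteq> {i. a i > 0} \<Longrightarrow> \<kappa> * vol W S \<le> variation R (indicator S)"
    and \<nu>: "\<nu> \<ge> 0"
      "(\<Sum>i\<in>UNIV. \<Sum>j\<in>UNIV. W i j * (if R i j then (a i)\<^sup>2 + (a j)\<^sup>2 else (a i - a j)\<^sup>2))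
         \<le> 2 * (1 - \<nu>) * sq_norm a"
  shows "\<kappa>\<^sup>2 \<le> 1 - \<nu>\<^sup>2"
proof -
  define p where "p i j = (if R i j then sqrt ((a i)\<^sup>2 + (a j)\<^sup>2) else \<bar>a i - a j\<bar>)" for i j
  define q where "q i j = (if R i j then sqrt ((a i)\<^sup>2 + (a j)\<^sup>2) else a i + a j)" for i j
  define P where "P = (\<Sum>i\<in>UNIV. \<Sum>j\<in>UNIV. W i j * (p i j)\<^sup>2)"
  define Q where "Q = (\<Sum>i\<in>UNIV. \<Sum>j\<in>UNIV. W i j * (q i j)\<^sup>2)"
  define F where "F = sq_norm a"
  have F: "F > 0" using a sq_norm_pos by (simp add: F_def)
  have PQ: "P + Q = 4 * F"
  proof -
    have pq2: "(p i j)\<^sup>2 + (q i j)\<^sup>2 = 2 * (a i)\<^sup>2 + 2 * (a j)\<^sup>2" for i j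
      by (simp add: p_def q_def power2_sum power2_diff)
    have "P + Q = (\<Sum>i\<in>UNIV. \<Sum>j\<in>UNIV. W i j * ((p i j)\<^sup>2 + (q i j)\<^sup>2))"
      by (simp add: P_def Q_def sum.distrib distrib_left)
    also have "\<dots> = 2 * (\<Sum>i\<in>UNIV. \<Sum>j\<in>UNIV. W i j * (a i)\<^sup>2) + 2 * (\<Sum>i\<in>UNIV. \<Sum>j\<in>UNIV. W i j * (a j)\<^sup>2)"
      unfolding pq2 by (simp add: sum.distrib sum_distrib_left algebra_simps)
    finally show ?thesis by (simp add: sum_fst sum_snd F_def sq_norm_def)
  qed
  have "\<kappa> * F \<le> variation R (\<lambda>i. (a i)\<^sup>2)"
    unfolding F_def sq_norm_def
  proof (rule variation_ge)
    fix S assume S: "S \<noteq> {}" "S \<subseteq> {i. (a i)\<^sup>2 > 0}"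
    then have "S \<subseteq> {i. a i > 0}" using a(1) by (auto simp: less_le)
    with S show "\<kappa> * vol W S \<le> variation R (indicator S)" by (intro \<kappa>)
  qed simp
  also have "variation R (\<lambda>i. (a i)\<^sup>2) = (\<Sum>(i,j)\<in>UNIV. (sqrt (W i j) * p i j) * (sqrt (W i j) * q i j)) / 2"
  proof -
    have "(if R i j then (a i)\<^sup>2 + (a j)\<^sup>2 else \<bar>(a i)\<^sup>2 - (a j)\<^sup>2\<bar>) = p i j * q i j" for i j
    proof -
      have "(a i)\<^sup>2 - (a j)\<^sup>2 = (a i - a j) * (a i + a j)" by (simp add: power2_eq_square algebra_simps)
      then show ?thesis using a(1)[of i] a(1)[of j] by (simp add: p_def q_def abs_mult)
    qed
    moreover have "(sqrt (W i j) * p i j) * (sqrt (W i j) * q i j) = W i j * (p i j * q i j)" for i j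
      using nonneg[of i j] by (simp add: mult_ac flip: real_sqrt_mult)
    ultimately show ?thesis
      by (simp only: variation_def sum.cartesian_product UNIV_Times_UNIV)
  qed
  finally have "2 * \<kappa> * F \<le> (\<Sum>(i,j)\<in>UNIV. (sqrt (W i j) * p i j) * (sqrt (W i j) * q i j))" by simp
  then have "(2 * \<kappa> * F)\<^sup>2 \<le> (\<Sum>(i,j)\<in>UNIV. (sqrt (W i j) * p i j) * (sqrt (W i j) * q i j))\<^sup>2"
    using \<kappa> F by (intro power_mono) auto
  also have "\<dots> = (\<Sum>x\<in>UNIV. (case x of (i,j) \<Rightarrow> sqrt (W i j) * p i j) * (case x of (i,j) \<Rightarrow> sqrt (W i j) * q i j))\<^sup>2"
    by (simp add: case_prod_unfold)
  also have "\<dots> \<le> (\<Sum>x\<in>UNIV. (case x of (i,j) \<Rightarrow> sqrt (W i j) * p i j)\<^sup>2) * (\<Sum>x\<in>UNIV. (case x of (i,j) \<Rightarrow> sqrt (W i j) * q i j)\<^sup>2)"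
    by (rule Cauchy_Schwarz_ineq_sum)
  also have "\<dots> = P * Q"
    by (simp add: P_def Q_def case_prod_unfold power_mult_distrib nonneg sum.cartesian_product)
  \<comment> \<open>\<open>P\<close> and \<open>Q\<close> have mean \<open>2 * F\<close>, so their
    product falls as \<open>P\<close> moves away from it; the hypothesis on \<open>\<nu>\<close>
    keeps \<open>P\<close> below the mean by at least \<open>2 * \<nu> * F\<close>.\<close>
  also have "\<dots> = (2 * F)\<^sup>2 - (2 * F - P)\<^sup>2"
  proof -
    have Q: "Q = 4 * F - P" using PQ by simp
    show ?thesis unfolding Q by (simp add: power2_eq_square algebra_simps)
  qed
  also have "\<dots> \<le> (2 * F)\<^sup>2 - (2 * \<nu> * F)\<^sup>2"
  proof -
    have "P = (\<Sum>i\<in>UNIV. \<Sum>j\<in>UNIV. W i j * (if R i j then (a i)\<^sup>2 + (a j)\<^sup>2 else (a i - a j)\<^sup>2))"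
      unfolding P_def p_def by (intro sum.cong refl) simp
    then have "2 * \<nu> * F \<le> 2 * F - P"
      using \<nu>(2) by (simp add: F_def algebra_simps)
    then show ?thesis using \<nu> F by (simp add: power_mono)
  qed
  finally have "(2 * F)\<^sup>2 * \<kappa>\<^sup>2 \<le> (2 * F)\<^sup>2 * (1 - \<nu>\<^sup>2)"
    by (simp add: power_mult_distrib algebra_simps)
  then show ?thesis using F by simp
qed

text \<open>The positive part keeps an energy quotient of at most \<open>1 - \<mu>\<close>, since
  replacing \<open>f j\<close> by its positive part only increases the products. Its support has at
  most half the volume, so for \<open>S\<close> inside it the minimum in the Cheeger quotient is
  \<open>vol W S\<close>.\<close>

lemma eigenvalue_cheeger_positive_part:
  assumes eig: "\<And>i. (\<Sum>j\<in>UNIV. W i j * f j) = \<mu> * deg W i * f i"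
    and pos: "f k > 0" and vol: "vol W {i. f i > 0} \<le> vol W (- {i. f i > 0})"
    and \<mu>: "\<mu> \<ge> 0" and \<kappa>: "\<kappa> \<ge> 0"
      "\<And>U. U \<noteq> {} \<Longrightarrow> - U \<noteq> {} \<Longrightarrow> \<kappa> * min (vol W U) (vol W (- U)) \<le> cut U (- U)"
  shows "\<kappa>\<^sup>2 \<le> 1 - \<mu>\<^sup>2"
proof (rule cheeger_estimate[where a = "\<lambda>i. max 0 (f i)" and R = "\<lambda>_ _. False" and k = k])
  define g where "g i = max 0 (f i)" for i
  have "(\<Sum>i\<in>UNIV. \<Sum>j\<in>UNIV. W i j * (g i * g j)) \<ge> (\<Sum>i\<in>UNIV. g i * (\<Sum>j\<in>UNIV. W i j * f j))"
    unfolding sum_distrib_left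
  proof (intro sum_mono)
    fix i j
    have "W i j * g i * f j \<le> W i j * g i * g j"
      by (intro mult_left_mono) (auto simp: g_def nonneg)
    then show "g i * (W i j * f j) \<le> W i j * (g i * g j)" by (simp add: mult_ac)
  qed
  also have "(\<Sum>i\<in>UNIV. g i * (\<Sum>j\<in>UNIV. W i j * f j)) = \<mu> * sq_norm g"
    unfolding eig sq_norm_def sum_distrib_left
    by (intro sum.cong) (auto simp: g_def power2_eq_square max_def)
  finally show "(\<Sum>i\<in>UNIV. \<Sum>j\<in>UNIV. W i j * (if False then (max 0 (f i))\<^sup>2 + (max 0 (f j))\<^sup>2 else (max 0 (f i) - max 0 (f j))\<^sup>2))
      \<le> 2 * (1 - \<mu>) * sq_norm (\<lambda>i. max 0 (f i))"
    using sum_diff_squares[of g] by (simp add: g_def[abs_def] algebra_simps)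
next
  fix S assume S: "S \<noteq> {}" "S \<subseteq> {i. max 0 (f i) > 0}"
  then have sub: "S \<subseteq> {i. f i > 0}" by auto
  have le: "vol W S \<le> vol W (- S)"
    using vol_mono[OF sub] vol vol_mono[of "- {i. f i > 0}" "- S"] sub by fastforce
  have "- S \<noteq> {}"
  proof
    assume "- S = {}"
    then have "vol W (- S) = 0" by (simp add: vol_def)
    then show False using le vol_pos[OF S(1)] by simp
  qed
  then have "\<kappa> * vol W S \<le> cut S (- S)" using \<kappa>(2)[OF S(1)] le by (simp add: min_def)
  also have "cut S (- S) = variation (\<lambda>_ _. False) (indicator S)"
  proof -
    \<comment> \<open>Each boundary edge occurs in both orders, which the division by 2 in
      \<open>variation\<close> compensates.\<close>
    have "W i j * \<bar>indicator S i - indicator S j\<bar> =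
       W i j * (indicator S i * indicator (- S) j) + W i j * (indicator (- S) i * indicator S j)" for i j
      by (auto simp: indicator_def)
    then show ?thesis
      by (simp add: variation_def sum.distrib cut_indicator cut_commute[of "- S" S])
  qed
  finally show "\<kappa> * vol W S \<le> variation (\<lambda>_ _. False) (indicator S)" .
qed (use pos \<mu> \<kappa> in auto)

text \<open>Orthogonality to the constants makes \<open>f\<close> take both signs. The sets where
  \<open>f\<close> and \<open>- f\<close> are positive are disjoint, so one of them has at most half
  the volume, and both functions are eigenfunctions.\<close>

lemma eigenvalue_cheeger:
  assumes eig: "\<And>i. (\<Sum>j\<in>UNIV. W i j * f j) = \<mu> * deg W i * f i"
    and f: "f k \<noteq> 0" "(\<Sum>i\<in>UNIV. deg W i * f i) = 0"
    and \<mu>: "\<mu> \<ge> 0" and \<kappa>: "\<kappa> \<ge> 0"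
      "\<And>U. U \<noteq> {} \<Longrightarrow> - U \<noteq> {} \<Longrightarrow> \<kappa> * min (vol W U) (vol W (- U)) \<le> cut U (- U)"
  shows "\<kappa>\<^sup>2 \<le> 1 - \<mu>\<^sup>2"
proof -
  have ex: "\<exists>i. g i > 0" if "g k \<noteq> 0" "(\<Sum>i\<in>UNIV. deg W i * g i) = 0" for g
  proof (rule ccontr)
    assume "\<nexists>i. g i > 0"
    then have "\<And>i. deg W i * - g i \<ge> 0"
      using deg_pos by (intro mult_nonneg_nonneg) (auto simp: not_less less_imp_le)
    then have "deg W k * - g k = 0"
      using that sum_nonneg_eq_0_iff[of UNIV "\<lambda>i. deg W i * - g i"] by (auto simp: sum_negf)
    then show False using that deg_pos[of k] by auto
  qed
  show ?thesis
  proof (cases "vol W {i. f i > 0} \<le> vol W (- {i. f i > 0})")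
    case True
    then show ?thesis using ex[OF f] eig \<mu> \<kappa> eigenvalue_cheeger_positive_part[of f \<mu>] by metis
  next
    case False
    have "vol W {i. - f i > 0} \<le> vol W (- {i. f i > 0})" by (rule vol_mono) auto
    also have "\<dots> \<le> vol W {i. f i > 0}" using False by simp
    also have "\<dots> \<le> vol W (- {i. - f i > 0})" by (rule vol_mono) auto
    finally have le: "vol W {i. - f i > 0} \<le> vol W (- {i. - f i > 0})" .
    obtain i where "- f i > 0" using ex[of "\<lambda>i. - f i"] f by (auto simp: sum_negf)
    then show ?thesis
      using le \<mu> \<kappa> by (intro eigenvalue_cheeger_positive_part[of "\<lambda>i. - f i" \<mu> i]) (auto simp: sum_negf eig)
  qed
qed

text \<open>The common estimate is applied to the absolute value of \<open>f\<close> with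
  \<open>\<nu> = - \<mu>\<close>. Splitting \<open>S\<close> by the sign of \<open>f\<close>, a
  small variation would mean a large cut between the two halves, which the hypothesis on cuts
  forbids.\<close>

lemma eigenvalue_dual_cheeger:
  assumes eig: "\<And>i. (\<Sum>j\<in>UNIV. W i j * f j) = \<mu> * deg W i * f i"
    and f: "f k \<noteq> 0" and \<mu>: "\<mu> \<le> 0" and \<kappa>: "0 \<le> \<kappa>" "\<kappa> \<le> 1"
      "\<And>A B. A \<noteq> {} \<Longrightarrow> B \<noteq> {} \<Longrightarrow> A \<inter> B = {} \<Longrightarrow> 2 * cut A B \<le> (1 - \<kappa>) * (vol W A + vol W B)"
  shows "\<kappa>\<^sup>2 \<le> 1 - \<mu>\<^sup>2"
proof -
  define R where "R i j \<longleftrightarrow> (f i \<ge> 0) = (f j \<ge> 0)" for i j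
  have "\<kappa>\<^sup>2 \<le> 1 - (- \<mu>)\<^sup>2"
  proof (rule cheeger_estimate[where a = "\<lambda>i. \<bar>f i\<bar>" and R = R and k = k])
    have "(\<Sum>i\<in>UNIV. \<Sum>j\<in>UNIV. W i j * (if R i j then \<bar>f i\<bar>\<^sup>2 + \<bar>f j\<bar>\<^sup>2 else (\<bar>f i\<bar> - \<bar>f j\<bar>)\<^sup>2))
      \<le> (\<Sum>i\<in>UNIV. \<Sum>j\<in>UNIV. W i j * (f i + f j)\<^sup>2)"
    proof (intro sum_mono mult_left_mono nonneg)
      fix i j
      \<comment> \<open>For opposite signs the two sides agree; for equal signs only the nonnegative
        term \<open>2 * f i * f j\<close> is dropped.\<close>
      show "(if R i j then \<bar>f i\<bar>\<^sup>2 + \<bar>f j\<bar>\<^sup>2 else (\<bar>f i\<bar> - \<bar>f j\<bar>)\<^sup>2) \<le> (f i + f j)\<^sup>2"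
        by (cases "f i \<ge> 0"; cases "f j \<ge> 0")
          (auto simp: R_def power2_sum power2_diff mult_nonpos_nonpos)
    qed
    also have "\<dots> = 2 * (1 - (- \<mu>)) * sq_norm f"
      using sum_eigen_product[OF eig] by (simp add: sum_add_squares algebra_simps)
    also have "sq_norm f = sq_norm (\<lambda>i. \<bar>f i\<bar>)" by (simp add: sq_norm_def)
    finally show "(\<Sum>i\<in>UNIV. \<Sum>j\<in>UNIV. W i j * (if R i j then \<bar>f i\<bar>\<^sup>2 + \<bar>f j\<bar>\<^sup>2 else (\<bar>f i\<bar> - \<bar>f j\<bar>)\<^sup>2))
      \<le> 2 * (1 - (- \<mu>)) * sq_norm (\<lambda>i. \<bar>f i\<bar>)" .
  next
    fix S :: "'v set" assume S: "S \<noteq> {}"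
    define A where "A = {i \<in> S. f i \<ge> 0}"
    define B where "B = {i \<in> S. f i < 0}"
    have AB: "A \<inter> B = {}" "S = A \<union> B" by (auto simp: A_def B_def)
    have "2 * cut A B \<le> (1 - \<kappa>) * (vol W A + vol W B)"
    proof (cases "A = {} \<or> B = {}")
      \<comment> \<open>A one-sided \<open>S\<close> gives no admissible pair; its cut is 0 and
        \<open>\<kappa> \<le> 1\<close> suffices.\<close>
      case True
      then have "cut A B = 0" by (auto simp: cut_def)
      then show ?thesis using \<kappa> by (simp add: vol_def sum_nonneg deg_pos less_imp_le)
    qed (use \<kappa> AB in auto)
    then have "\<kappa> * vol W S \<le> vol W S - 2 * cut A B"
      using AB by (simp add: vol_Un algebra_simps)
    also have "\<dots> = variation R (indicator S)"
    proof -
      \<comment> \<open>Against the full count \<open>indicator S i + indicator S j\<close>, only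
        edges between \<open>A\<close> and \<open>B\<close> lose anything, and they lose both
        ends.\<close>
      have "W i j * (if R i j then indicator S i + indicator S j else \<bar>indicator S i - indicator S j\<bar>) =
         W i j * indicator S i + W i j * indicator S j - 2 * (W i j * (indicator A i * indicator B j))
         - 2 * (W i j * (indicator B i * indicator A j))" for i j
        by (cases "i \<in> S"; cases "j \<in> S"; cases "f i \<ge> 0"; cases "f j \<ge> 0")
          (simp_all add: A_def B_def R_def)
      moreover have S: "(\<Sum>i\<in>UNIV. deg W i * indicator S i) = vol W S"
        by (simp add: vol_def)
      have "(\<Sum>i\<in>UNIV. \<Sum>j\<in>UNIV. W i j * indicator S i) = vol W S"
        "(\<Sum>i\<in>UNIV. \<Sum>j\<in>UNIV. W i j * indicator S j) = vol W S"
        unfolding sum_fst sum_snd by (fact S)+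
      ultimately have "variation R (indicator S) = (vol W S + vol W S - 2 * cut A B - 2 * cut B A) / 2"
        by (simp only: variation_def sum.distrib sum_subtractf cut_indicator flip: sum_distrib_left)
      then show ?thesis by (simp add: cut_commute[of B A])
    qed
    finally show "\<kappa> * vol W S \<le> variation R (indicator S)" .
  qed (use f \<mu> \<kappa> in auto)
  then show ?thesis by simp
qed

end

section \<open>Neighborhood graphs\<close>

lemma neighborhood_weight_1: "neighborhood_weight w (Suc 0) i j = w i j"
  by (simp add: neighborhood_weight_def)

text \<open>Splitting the list of intermediate vertices at its head detaches the first step of the
  walk.\<close>

lemma neighborhood_weight_Suc:
  "neighborhood_weight w (Suc (Suc n)) i j =
     (\<Sum>k\<in>UNIV. w i k / deg w k * neighborhood_weight w (Suc n) k j)"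
proof -
  let ?g = "\<lambda>i ks. (\<Prod>k\<leftarrow>ks. 1 / deg w k) *
     (\<Prod>t<Suc (length ks). w ((i # ks @ [j]) ! t) ((i # ks @ [j]) ! Suc t))"
  have split: "{ks :: 'a list. length ks = Suc n} = (\<lambda>(k, ks). k # ks) ` (UNIV \<times> {ks. length ks = n})"
    by (auto simp: length_Suc_conv image_iff)
  have step: "?g i (k # ks) = w i k / deg w k * ?g k ks" for k ks
    unfolding length_Cons prod.lessThan_Suc_shift[of _ "Suc (length ks)"] by simp
  have "neighborhood_weight w (Suc (Suc n)) i j = (\<Sum>ks | length ks = Suc n. ?g i ks)"
    by (simp add: neighborhood_weight_def)
  also have "\<dots> = (\<Sum>(k, ks)\<in>UNIV \<times> {ks. length ks = n}. w i k / deg w k * ?g k ks)"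
    unfolding split
  proof (subst sum.reindex)
    show "inj_on (\<lambda>(k, ks). k # ks) (UNIV \<times> {ks :: 'a list. length ks = n})"
      by (auto simp: inj_on_def)
  qed (intro sum.cong refl, simp only: case_prod_unfold o_def step)
  also have "\<dots> = (\<Sum>k\<in>UNIV. w i k / deg w k * (\<Sum>ks | length ks = n. ?g k ks))"
    by (simp add: sum.cartesian_product[symmetric] sum_distrib_left del: prod.lessThan_Suc)
  also have "\<dots> = (\<Sum>k\<in>UNIV. w i k / deg w k * neighborhood_weight w (Suc n) k j)"
    by (intro sum.cong refl arg_cong2[where f = "(*)"])
      (auto simp: neighborhood_weight_def simp del: prod.lessThan_Suc)
  finally show ?thesis .
qed

text \<open>
  Starting the recursion with the diagonal matrix of degrees makes the composition law
  \<open>walk_weight_add\<close> valid for walks of length 0 too; \<open>neighborhood_weight w 0\<close> is different.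
\<close>

primrec walk_weight :: "('v::finite \<Rightarrow> 'v \<Rightarrow> real) \<Rightarrow> nat \<Rightarrow> 'v \<Rightarrow> 'v \<Rightarrow> real" where
  "walk_weight w 0 i j = (if i = j then deg w i else 0)"
| "walk_weight w (Suc n) i j = (\<Sum>k\<in>UNIV. w i k / deg w k * walk_weight w n k j)"

section \<open>Walk weights and return probabilities\<close>

context weight_matrix
begin

lemma deg_neq_0 [simp]: "deg W i \<noteq> 0"
  using deg_pos[of i] by simp

lemma neighborhood_weight_eq_walk_weight:
  assumes "l > 0"
  shows "neighborhood_weight W l = walk_weight W l"
proof -
  have "neighborhood_weight W (Suc n) i j = walk_weight W (Suc n) i j" for n i j
  proof (induction n arbitrary: i)
    case 0
    have "(\<Sum>k\<in>UNIV. W i k / deg W k * (if k = j then deg W k else 0)) = W i j"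
      by (simp add: if_distrib[of "times _"] cong: if_cong)
    then show ?case by (simp add: neighborhood_weight_1)
  qed (simp add: neighborhood_weight_Suc)
  then show ?thesis using assms by (cases l) (simp_all add: fun_eq_iff del: walk_weight.simps)
qed

text \<open>Chapman-Kolmogorov relation: \<open>walk_weight W n i j / deg W i\<close> is the
  \<open>n\<close>-step transition probability, so one degree is divided out at the meeting
  vertex.\<close>

lemma walk_weight_add:
  "walk_weight W (m + n) i j = (\<Sum>k\<in>UNIV. walk_weight W m i k * walk_weight W n k j / deg W k)"
proof (induction m arbitrary: i)
  case 0
  have "(\<Sum>k\<in>UNIV. (if i = k then deg W i else 0) * walk_weight W n k j / deg W k) =
      (\<Sum>k\<in>UNIV. if i = k then walk_weight W n k j else 0)"
    by (intro sum.cong) auto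
  then show ?case by simp
next
  case (Suc m)
  have "walk_weight W (Suc m + n) i j =
      (\<Sum>k\<in>UNIV. \<Sum>l\<in>UNIV. W i k / deg W k * (walk_weight W m k l * walk_weight W n l j / deg W l))"
    by (simp add: Suc sum_distrib_left)
  also have "\<dots> = (\<Sum>l\<in>UNIV. walk_weight W (Suc m) i l * walk_weight W n l j / deg W l)"
    by (subst sum.swap) (simp add: sum_distrib_left sum_distrib_right sum_divide_distrib mult_ac)
  finally show ?case .
qed

lemma walk_weight_Suc_0: "walk_weight W (Suc 0) i j = W i j"
  by (simp add: neighborhood_weight_1 del: walk_weight.simps flip: neighborhood_weight_eq_walk_weight)

text \<open>The recursion detaches the first step and the composition law the last one; comparing
  the two reverses the walk.\<close>

lemma walk_weight_commute: "walk_weight W n i j = walk_weight W n j i"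
proof (induction n arbitrary: i j)
  case (Suc n)
  have "walk_weight W (Suc n) i j = (\<Sum>k\<in>UNIV. walk_weight W n i k * W k j / deg W k)"
    using walk_weight_add[of n "Suc 0" i j] by (simp only: walk_weight_Suc_0) simp
  also have "\<dots> = (\<Sum>k\<in>UNIV. W j k / deg W k * walk_weight W n k i)"
    by (intro sum.cong refl) (simp add: sym[of _ j] Suc[of i])
  finally show ?case by simp
qed auto

lemma walk_weight_nonneg: "walk_weight W n i j \<ge> 0"
  by (induction n arbitrary: i) (auto simp: nonneg deg_pos less_imp_le intro!: sum_nonneg)

text \<open>\<open>\<mu>\<close> is an eigenvalue of the random walk operator, and
  \<open>walk_weight W n\<close> is the \<open>n\<close>-th power of that operator with row
  \<open>i\<close> scaled by \<open>deg W i\<close>.\<close>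

lemma walk_weight_eigen:
  assumes "\<And>i. (\<Sum>j\<in>UNIV. W i j * f j) = \<mu> * deg W i * f i"
  shows "(\<Sum>j\<in>UNIV. walk_weight W n i j * f j) = \<mu> ^ n * deg W i * f i"
proof (induction n arbitrary: i)
  case 0
  then show ?case by (simp add: if_distrib[of "\<lambda>x. x * _"] cong: if_cong)
next
  case (Suc n)
  have "(\<Sum>j\<in>UNIV. walk_weight W (Suc n) i j * f j) =
      (\<Sum>j\<in>UNIV. \<Sum>k\<in>UNIV. W i k / deg W k * (walk_weight W n k j * f j))"
    by (simp add: sum_distrib_left mult_ac)
  also have "\<dots> = (\<Sum>k\<in>UNIV. W i k / deg W k * (\<Sum>j\<in>UNIV. walk_weight W n k j * f j))"
    by (subst sum.swap) (simp add: sum_distrib_left)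
  also have "\<dots> = \<mu> ^ n * (\<Sum>k\<in>UNIV. W i k * f k)"
    unfolding Suc by (simp add: sum_distrib_left mult_ac)
  finally show ?case by (simp add: assms)
qed

lemma deg_walk_weight: "deg (walk_weight W n) i = deg W i"
  using walk_weight_eigen[of "\<lambda>_. 1" 1] by (simp add: deg_def)

text \<open>A closed walk of length \<open>n + n\<close> consists of two walks of length
  \<open>n\<close> meeting at some \<open>k\<close>, which gives a sum of squares; Cauchy-Schwarz
  compares it with the total \<open>deg W i\<close> of the walks from \<open>i\<close>.\<close>

lemma walk_weight_even_ge: "walk_weight W (n + n) i i \<ge> (deg W i)\<^sup>2 / vol W UNIV"
proof -
  have vol: "vol W UNIV > 0" by (simp add: vol_pos)
  have "(deg W i)\<^sup>2 = (\<Sum>k\<in>UNIV. sqrt (deg W k) * (walk_weight W n i k / sqrt (deg W k)))\<^sup>2"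
    using deg_walk_weight[of n i] by (simp add: deg_def[of "walk_weight W n"])
  also have "\<dots> \<le> (\<Sum>k\<in>UNIV. (sqrt (deg W k))\<^sup>2) * (\<Sum>k\<in>UNIV. (walk_weight W n i k / sqrt (deg W k))\<^sup>2)"
    by (rule Cauchy_Schwarz_ineq_sum)
  also have "(\<Sum>k\<in>UNIV. (sqrt (deg W k))\<^sup>2) = vol W UNIV"
    using deg_pos by (simp add: vol_def less_imp_le)
  also have "(\<Sum>k\<in>UNIV. (walk_weight W n i k / sqrt (deg W k))\<^sup>2) = walk_weight W (n + n) i i"
    using deg_pos
    by (simp add: walk_weight_add walk_weight_commute[of n _ i] power_divide less_imp_le power2_eq_square[of "walk_weight W n i _"])
  finally show ?thesis using vol by (simp add: pos_divide_le_eq mult_ac)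
qed

text \<open>Only the walks that are back at \<open>i\<close> just before the last step are
  kept.\<close>

lemma walk_weight_odd_ge: "walk_weight W (Suc (n + n)) i j \<ge> deg W i / vol W UNIV * W i j"
proof -
  have "deg W i / vol W UNIV * W i j = ((deg W i)\<^sup>2 / vol W UNIV) * W i j / deg W i"
    by (simp add: power2_eq_square)
  also have "\<dots> \<le> walk_weight W (n + n) i i * W i j / deg W i"
    using deg_pos[of i] nonneg[of i j] walk_weight_even_ge[of i n]
    by (intro divide_right_mono mult_right_mono) auto
  also have "\<dots> \<le> (\<Sum>k\<in>UNIV. walk_weight W (n + n) i k * W k j / deg W k)"
    by (rule member_le_sum[where f = "\<lambda>k. walk_weight W (n + n) i k * W k j / deg W k"])
      (auto simp: walk_weight_nonneg nonneg deg_pos less_imp_le)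
  also have "\<dots> = walk_weight W (Suc (n + n)) i j"
    using walk_weight_add[of "n + n" "Suc 0" i j] by (simp only: walk_weight_Suc_0) simp
  finally show ?thesis .
qed

section \<open>Cuts and volumes of the neighborhood graphs\<close>

lemma weight_matrix_neighborhood:
  assumes "l > 0"
  shows "weight_matrix (neighborhood_weight W l)"
  unfolding neighborhood_weight_eq_walk_weight[OF assms]
  by unfold_locales
    (rule walk_weight_commute walk_weight_nonneg | simp only: deg_walk_weight deg_pos)+

lemma vol_neighborhood:
  assumes "l > 0"
  shows "vol (neighborhood_weight W l) = vol W"
  by (simp add: fun_eq_iff vol_def neighborhood_weight_eq_walk_weight[OF assms] deg_walk_weight)

lemma edge_weight_eq_cut:
  assumes "l > 0"
  shows "edge_weight W l = weight_matrix.cut (neighborhood_weight W l)"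
  by (simp add: fun_eq_iff edge_weight_def weight_matrix.cut_def[OF weight_matrix_neighborhood[OF assms]])

lemma edge_weight_nonneg: "l > 0 \<Longrightarrow> edge_weight W l A B \<ge> 0"
  by (simp add: edge_weight_eq_cut weight_matrix.cut_nonneg weight_matrix_neighborhood)

lemma edge_weight_commute: "l > 0 \<Longrightarrow> edge_weight W l A B = edge_weight W l B A"
  by (simp add: edge_weight_eq_cut weight_matrix.cut_commute[OF weight_matrix_neighborhood])

lemma edge_weight_split:
  assumes "l > 0"
  shows "vol W A = edge_weight W l A A + edge_weight W l A (- A)"
  using weight_matrix.vol_split[OF weight_matrix_neighborhood[OF assms], of A]
  unfolding edge_weight_eq_cut[OF assms] vol_neighborhood[OF assms] .

lemma edge_weight_le_vol:
  assumes l: "l > 0" and "A \<inter> B = {}"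
  shows "edge_weight W l A B \<le> vol W A"
proof -
  have "edge_weight W l A B \<le> edge_weight W l A (- A)"
    unfolding edge_weight_def using assms
    by (intro sum_mono sum_mono2) (auto simp: neighborhood_weight_eq_walk_weight walk_weight_nonneg)
  then show ?thesis using edge_weight_split[OF l, of A] edge_weight_nonneg[OF l, of A A] by simp
qed

lemma min_vol_pos: "A \<noteq> {} \<Longrightarrow> - A \<noteq> {} \<Longrightarrow> min (vol W A) (vol W (- A)) > 0"
  by (simp add: vol_pos)

lemma cheeger_le:
  assumes "A \<noteq> {}" "- A \<noteq> {}"
  shows "cheeger W l * min (vol W A) (vol W (- A)) \<le> edge_weight W l A (- A)"
proof -
  have "cheeger W l \<le> edge_weight W l A (- A) / min (vol W A) (vol W (- A))"
    unfolding cheeger_def using assms by (intro Min_le) auto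
  then show ?thesis using min_vol_pos[OF assms] by (simp add: pos_le_divide_eq)
qed

lemma dual_cheeger_ge:
  assumes "A \<noteq> {}" "B \<noteq> {}" "A \<inter> B = {}"
  shows "2 * edge_weight W l A B \<le> dual_cheeger W l * (vol W A + vol W B)"
proof -
  have "2 * edge_weight W l A B / (vol W A + vol W B) \<le> dual_cheeger W l"
    unfolding dual_cheeger_def using assms by (intro Max_ge) force+
  then show ?thesis using vol_pos[of A] vol_pos[of B] assms by (simp add: pos_divide_le_eq)
qed

end

text \<open>Connectedness phrased through cuts, the form that yields a positive Cheeger constant, a
  one-dimensional kernel of the Laplacian and an edge between distinct vertices.\<close>

locale connected_weight = weight_matrix W for W :: "'v::finite \<Rightarrow> 'v \<Rightarrow> real" +
  assumes crossing: "A \<noteq> {} \<Longrightarrow> - A \<noteq> {} \<Longrightarrow> \<exists>i\<in>A. \<exists>j\<in>- A. W i j > 0"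
    and card_ge_2: "CARD('v) \<ge> 2"
begin

section \<open>Bounds on the Cheeger constants, uniform in the length\<close>

lemma ex_proper: "\<exists>A :: 'v set. A \<noteq> {} \<and> - A \<noteq> {}"
proof -
  have "- {undefined :: 'v} \<noteq> {}"
  proof
    assume "- {undefined :: 'v} = {}"
    then have "UNIV = {undefined :: 'v}" by blast
    then have "CARD('v) = 1" by (metis card_1_singleton_iff One_nat_def)
    then show False using card_ge_2 by simp
  qed
  then show ?thesis by blast
qed

lemma cheeger_attained:
  obtains A where "A \<noteq> {}" "- A \<noteq> {}"
    "cheeger W l * min (vol W A) (vol W (- A)) = edge_weight W l A (- A)"
proof -
  have "cheeger W l \<in> (\<lambda>U. edge_weight W l U (- U) / min (vol W U) (vol W (- U))) ` {U. U \<noteq> {} \<and> - U \<noteq> {}}"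
    unfolding cheeger_def using ex_proper by (intro Min_in) auto
  then obtain A where A: "A \<noteq> {}" "- A \<noteq> {}"
    "cheeger W l = edge_weight W l A (- A) / min (vol W A) (vol W (- A))" by blast
  have "min (vol W A) (vol W (- A)) \<noteq> 0" using min_vol_pos[OF A(1,2)] by linarith
  then have "cheeger W l * min (vol W A) (vol W (- A)) = edge_weight W l A (- A)"
    unfolding A(3) by simp
  with A(1,2) show thesis by (rule that)
qed

lemma dual_cheeger_attained:
  obtains A B where "A \<noteq> {}" "B \<noteq> {}" "A \<inter> B = {}"
    "2 * edge_weight W l A B = dual_cheeger W l * (vol W A + vol W B)"
proof -
  obtain C :: "'v set" where "C \<noteq> {}" "- C \<noteq> {}" using ex_proper by blast
  then have "(C, - C) \<in> {(V1, V2). V1 \<noteq> {} \<and> V2 \<noteq> {} \<and> V1 \<inter> V2 = {}}" by auto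
  then have "dual_cheeger W l \<in> (\<lambda>(V1, V2). 2 * edge_weight W l V1 V2 / (vol W V1 + vol W V2)) `
          {(V1, V2). V1 \<noteq> {} \<and> V2 \<noteq> {} \<and> V1 \<inter> V2 = {}}"
    unfolding dual_cheeger_def by (intro Max_in) (auto simp only: finite image_is_empty)
  then obtain A B where A: "A \<noteq> {}" "B \<noteq> {}" "A \<inter> B = {}"
    "dual_cheeger W l = 2 * edge_weight W l A B / (vol W A + vol W B)" by auto
  have "vol W A + vol W B \<noteq> 0" using vol_pos[OF A(1)] vol_pos[OF A(2)] by simp
  then have "2 * edge_weight W l A B = dual_cheeger W l * (vol W A + vol W B)"
    unfolding A(4) by simp
  with A(1-3) show thesis by (rule that)
qed

lemma cheeger_bounds:
  assumes l: "l > 0"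
  shows "cheeger W l \<ge> 0" "cheeger W l \<le> 1"
proof -
  obtain A where A: "A \<noteq> {}" "- A \<noteq> {}"
    "cheeger W l * min (vol W A) (vol W (- A)) = edge_weight W l A (- A)"
    by (rule cheeger_attained)
  have pos: "min (vol W A) (vol W (- A)) > 0" using min_vol_pos[OF A(1,2)] .
  have "0 \<le> cheeger W l * min (vol W A) (vol W (- A))"
    unfolding A(3) by (rule edge_weight_nonneg[OF l])
  then show "cheeger W l \<ge> 0" using pos by (simp add: zero_le_mult_iff del: min_less_iff_conj)
  have "edge_weight W l A (- A) \<le> min (vol W A) (vol W (- A))"
    using edge_weight_le_vol[OF l, of A "- A"] edge_weight_le_vol[OF l, of "- A" A]
      edge_weight_commute[OF l, of A "- A"] by simp
  then have "cheeger W l * min (vol W A) (vol W (- A)) \<le> 1 * min (vol W A) (vol W (- A))"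
    unfolding A(3) by simp
  then show "cheeger W l \<le> 1" using pos by (rule mult_right_le_imp_le)
qed

lemma cheeger_1_pos: "cheeger W 1 > 0"
proof -
  obtain A where A: "A \<noteq> {}" "- A \<noteq> {}"
    "cheeger W 1 * min (vol W A) (vol W (- A)) = edge_weight W 1 A (- A)"
    by (rule cheeger_attained)
  obtain i j where ij: "i \<in> A" "j \<in> - A" "W i j > 0" using crossing[OF A(1,2)] by blast
  have "0 < (\<Sum>j\<in>- A. W i j)"
    by (rule sum_pos2[of _ j]) (use ij nonneg in auto)
  then have "0 < (\<Sum>i\<in>A. \<Sum>j\<in>- A. W i j)"
    by (rule sum_pos2[rotated 2]) (use ij nonneg in \<open>auto intro!: sum_nonneg\<close>)
  then have "0 < edge_weight W 1 A (- A)"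
    by (simp add: edge_weight_def neighborhood_weight_1)
  then show ?thesis unfolding A(3)[symmetric] using min_vol_pos[OF A(1,2)] by (simp add: zero_less_mult_iff del: min_less_iff_conj)
qed

lemma dual_cheeger_bounds:
  assumes l: "l > 0"
  shows "dual_cheeger W l \<ge> 0" "dual_cheeger W l \<le> 1"
proof -
  obtain A B where A: "A \<noteq> {}" "B \<noteq> {}" "A \<inter> B = {}"
    "2 * edge_weight W l A B = dual_cheeger W l * (vol W A + vol W B)"
    by (rule dual_cheeger_attained)
  have pos: "vol W A + vol W B > 0" using vol_pos[of A] vol_pos[of B] A by simp
  have "0 \<le> dual_cheeger W l * (vol W A + vol W B)"
    unfolding A(4)[symmetric] using edge_weight_nonneg[OF l] by simp
  then show "dual_cheeger W l \<ge> 0" using pos by (simp add: zero_le_mult_iff)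
  have "2 * edge_weight W l A B \<le> vol W A + vol W B"
    using edge_weight_le_vol[OF l, of A B] edge_weight_le_vol[OF l, of B A]
      edge_weight_commute[OF l, of A B] A(3) by (simp add: Int_commute)
  then show "dual_cheeger W l \<le> 1" unfolding A(4) using pos
    by (simp add: mult_le_cancel_right1)
qed

text \<open>A single vertex serves as test set: after an even number of steps, the return
  probability keeps a fixed share of its degree from leaving.\<close>

lemma cheeger_even_le:
  obtains c where "c < 1" "\<And>l. l > 0 \<Longrightarrow> even l \<Longrightarrow> cheeger W l \<le> c"
proof -
  obtain C :: "'v set" where "C \<noteq> {}" "- C \<noteq> {}" using ex_proper by blast
  then obtain a b :: 'v where "a \<in> C" "b \<in> - C" by blast
  then have "a \<noteq> b" by auto
  \<comment> \<open>The vertex of smaller degree is chosen so that \<open>{i}\<close> is the side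
    with the smaller volume.\<close>
  have "\<exists>i j :: 'v. i \<noteq> j \<and> deg W i \<le> deg W j"
  proof (cases "deg W a \<le> deg W b")
    case True
    with \<open>a \<noteq> b\<close> show ?thesis by (intro exI[of _ a] exI[of _ b]) simp
  next
    case False
    with \<open>a \<noteq> b\<close> show ?thesis by (intro exI[of _ b] exI[of _ a]) simp
  qed
  then obtain i j :: 'v where ij: "i \<noteq> j" "deg W i \<le> deg W j" by (elim exE conjE)
  have vi: "vol W {i} = deg W i" by (simp add: vol_def)
  have "j \<in> - {i}" using ij(1) by simp
  then have ne: "- {i} \<noteq> {}" by force
  have "vol W {i} \<le> vol W {j}" using ij by (simp add: vol_def)
  also have "\<dots> \<le> vol W (- {i})" using ij by (intro vol_mono) auto
  finally have le: "deg W i \<le> vol W (- {i})" by (simp add: vi)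
  show thesis
  proof
    show "1 - deg W i / vol W UNIV < 1" using deg_pos[of i] vol_pos[of UNIV] by simp
  next
    fix l :: nat assume l: "l > 0" "even l"
    then have "l = l div 2 + l div 2" by presburger
    then obtain n where n: "l = n + n" by blast
    have "cheeger W l * deg W i \<le> edge_weight W l {i} (- {i})"
      using cheeger_le[of "{i}" l] ne le by (simp add: vi min_absorb1)
    also have "\<dots> = deg W i - walk_weight W l i i"
      using edge_weight_split[OF l(1), of "{i}"] l
      by (simp add: vol_def edge_weight_def neighborhood_weight_eq_walk_weight)
    also have "\<dots> \<le> (1 - deg W i / vol W UNIV) * deg W i"
      using walk_weight_even_ge[of i n] by (simp add: n power2_eq_square algebra_simps)
    finally show "cheeger W l \<le> 1 - deg W i / vol W UNIV"
      using deg_pos[of i] by simp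
  qed
qed

text \<open>Even lengths are bounded already. For odd ones the test set is the smaller side
  \<open>U\<close> of an optimal cut of the original graph: a constant below 1 leaves weight
  \<open>e > 0\<close> inside \<open>U\<close>, and odd walks retain at least the share
  \<open>d\<close> of it.\<close>

lemma cheeger_bounded_away:
  assumes "cheeger W 1 \<noteq> 1"
  obtains c where "c < 1" "\<And>l. l > 0 \<Longrightarrow> cheeger W l \<le> c"
proof -
  obtain c0 where c0: "c0 < 1" "\<And>l. l > 0 \<Longrightarrow> even l \<Longrightarrow> cheeger W l \<le> c0"
    by (rule cheeger_even_le) blast
  obtain A where A: "A \<noteq> {}" "- A \<noteq> {}"
    "cheeger W 1 * min (vol W A) (vol W (- A)) = edge_weight W 1 A (- A)"
    by (rule cheeger_attained)
  define U where "U = (if vol W A \<le> vol W (- A) then A else - A)"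
  have U: "U \<noteq> {}" "- U \<noteq> {}" "vol W U \<le> vol W (- U)"
    "cheeger W 1 * vol W U = edge_weight W 1 U (- U)"
    using A edge_weight_commute[of 1 A "- A"] by (auto simp: U_def min_def)
  have volU: "vol W U > 0" using U vol_pos by blast
  define e where "e = edge_weight W 1 U U"
  define d where "d = Min (range (deg W)) / vol W UNIV"
  have "Min (range (deg W)) > 0" using deg_pos by simp
  then have d: "d > 0" using vol_pos[of UNIV] by (simp add: d_def)
  have "cheeger W 1 < 1" using assms cheeger_bounds[of 1] by simp
  then have "cheeger W 1 * vol W U < 1 * vol W U" using volU by (rule mult_strict_right_mono)
  then have "edge_weight W 1 U (- U) < vol W U" using U(4) by simp
  then have e: "e > 0" using edge_weight_split[of 1 U] by (simp add: e_def)
  have odd: "cheeger W l \<le> 1 - d * e / vol W U" if l: "l > 0" "odd l" for l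
  proof -
    have "l = Suc (l div 2 + l div 2)" using l by presburger
    then obtain n where n: "l = Suc (n + n)" by blast
    have "d * W i j \<le> walk_weight W l i j" for i j
    proof -
      have "d * W i j \<le> deg W i / vol W UNIV * W i j"
        unfolding d_def using nonneg vol_pos[of UNIV] by (intro mult_right_mono divide_right_mono) auto
      also have "\<dots> \<le> walk_weight W l i j" unfolding n by (rule walk_weight_odd_ge)
      finally show ?thesis .
    qed
    then have "d * e \<le> edge_weight W l U U"
      unfolding e_def edge_weight_def sum_distrib_left using l
      by (intro sum_mono) (simp add: neighborhood_weight_1 neighborhood_weight_eq_walk_weight[OF l(1)])
    moreover have "cheeger W l * vol W U \<le> edge_weight W l U (- U)"
      using cheeger_le[OF U(1,2), of l] U(3) by (simp add: min_def)
    ultimately have "cheeger W l * vol W U \<le> vol W U - d * e"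
      using edge_weight_split[OF l(1), of U] by simp
    then show ?thesis using volU by (simp add: field_simps)
  qed
  show thesis
  proof
    show "max c0 (1 - d * e / vol W U) < 1" using c0 d e volU by simp
    show "cheeger W l \<le> max c0 (1 - d * e / vol W U)" if "l > 0" for l
      using c0(2)[OF that] odd[OF that] by (cases "even l") auto
  qed
qed

text \<open>The ends of one fixed edge that is not a loop form the test pair; walks of every odd
  length keep a fixed share of its weight.\<close>

lemma dual_cheeger_odd_ge:
  obtains c where "c < 1" "\<And>l. l > 0 \<Longrightarrow> odd l \<Longrightarrow> 1 - dual_cheeger W l \<le> c"
proof -
  obtain C :: "'v set" where "C \<noteq> {}" "- C \<noteq> {}" using ex_proper by blast
  from crossing[OF this] obtain i j where "i \<in> C" "j \<in> - C" and Wij: "W i j > 0" by blast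
  then have ij: "i \<noteq> j" "W i j > 0" by auto
  define c where "c = 2 * (deg W i / vol W UNIV * W i j) / (deg W i + deg W j)"
  have pos: "deg W i + deg W j > 0" using deg_pos[of i] deg_pos[of j] by simp
  show thesis
  proof
    show "1 - c < 1" using pos deg_pos[of i] vol_pos[of UNIV] ij by (simp add: c_def)
    fix l :: nat assume l: "l > 0" "odd l"
    then have "l = Suc (l div 2 + l div 2)" by presburger
    then obtain n where n: "l = Suc (n + n)" by blast
    have "2 * edge_weight W l {i} {j} \<le> dual_cheeger W l * (vol W {i} + vol W {j})"
      using ij by (intro dual_cheeger_ge) auto
    then have "2 * walk_weight W l i j \<le> dual_cheeger W l * (deg W i + deg W j)"
      using l by (simp add: edge_weight_def vol_def neighborhood_weight_eq_walk_weight)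
    then have "2 * (deg W i / vol W UNIV * W i j) \<le> dual_cheeger W l * (deg W i + deg W j)"
      using walk_weight_odd_ge[of i j n] by (simp add: n)
    then have "c \<le> dual_cheeger W l"
      unfolding c_def using pos by (simp only: pos_divide_le_eq)
    then show "1 - dual_cheeger W l \<le> 1 - c" by simp
  qed
qed

end

section \<open>The spectrum of the Laplacian\<close>

context weight_matrix
begin

text \<open>Passes from a Laplacian eigenvalue \<open>\<mu>\<close> to the eigenvalue
  \<open>1 - \<mu>\<close> of the random walk, the form that \<open>walk_weight_eigen\<close>
  takes.\<close>

lemma eigenspace_iff:
  "v \<in> eigenspace W \<mu> \<longleftrightarrow> (\<forall>i. (\<Sum>j\<in>UNIV. W i j * v $ j) = (1 - \<mu>) * deg W i * v $ i)"
proof -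
  have "(\<Sum>j\<in>UNIV. W i j * (v $ i - v $ j)) = deg W i * v $ i - (\<Sum>j\<in>UNIV. W i j * v $ j)" for i
    by (simp add: right_diff_distrib sum_subtractf deg_def sum_distrib_right)
  then have "laplacian W v $ i = v $ i - (\<Sum>j\<in>UNIV. W i j * v $ j) / deg W i" for i
    by (simp add: laplacian_def diff_divide_distrib)
  moreover have "v $ i - S / deg W i = \<mu> * v $ i \<longleftrightarrow> S = (1 - \<mu>) * deg W i * v $ i" for i S
    by (auto simp: field_simps)
  ultimately show ?thesis
    by (simp add: eigenspace_def vec_eq_iff)
qed

text \<open>
  The Laplacian is self-adjoint for the inner product weighted by the degrees; multiplication by
  \<open>sqrt d\<close> carries it to an operator that is self-adjoint for the standard one.
\<close>

definition sym_laplacian :: "real ^ 'v \<Rightarrow> real ^ 'v" where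
  "sym_laplacian x = (\<chi> i. x $ i - (\<Sum>j\<in>UNIV. W i j / (sqrt (deg W i) * sqrt (deg W j)) * x $ j))"

definition rescale :: "real ^ 'v \<Rightarrow> real ^ 'v" where
  "rescale v = (\<chi> i. sqrt (deg W i) * v $ i)"

lemma abs_deg [simp]: "\<bar>deg W i\<bar> = deg W i"
  using deg_pos[of i] by simp

lemma rescale_nth: "rescale v $ i = sqrt (deg W i) * v $ i"
  by (simp add: rescale_def)

lemma sqrt_deg_square [simp]: "sqrt (deg W i) * sqrt (deg W i) = deg W i"
  using deg_pos[of i] by simp

lemma linear_sym_laplacian: "linear sym_laplacian"
  by (rule linearI)
    (simp_all add: sym_laplacian_def vec_eq_iff algebra_simps sum.distrib sum_distrib_left add_divide_distrib)

lemma linear_rescale: "linear rescale"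
  by (rule linearI) (simp_all add: rescale_def vec_eq_iff algebra_simps)

lemma inj_rescale: "inj rescale"
  by (auto simp: inj_def rescale_def vec_eq_iff)

lemma surj_rescale: "surj rescale"
  by (simp add: linear_injective_imp_surjective linear_rescale inj_rescale)

lemma sym_laplacian_selfadjoint: "sym_laplacian x \<bullet> y = x \<bullet> sym_laplacian y"
proof -
  let ?M = "\<lambda>i j. W i j / (sqrt (deg W i) * sqrt (deg W j))"
  have "(\<Sum>i\<in>UNIV. (\<Sum>j\<in>UNIV. ?M i j * x $ j) * y $ i) = (\<Sum>j\<in>UNIV. \<Sum>i\<in>UNIV. ?M i j * x $ j * y $ i)"
    unfolding sum_distrib_right by (rule sum.swap)
  also have "\<dots> = (\<Sum>i\<in>UNIV. x $ i * (\<Sum>j\<in>UNIV. ?M i j * y $ j))"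
    unfolding sum_distrib_left by (intro sum.cong refl) (simp add: sym mult_ac)
  finally show ?thesis
    by (simp add: sym_laplacian_def inner_vec_def algebra_simps sum_subtractf)
qed

lemma sym_laplacian_rescale:
  "sym_laplacian (rescale v) $ i = (deg W i * v $ i - (\<Sum>j\<in>UNIV. W i j * v $ j)) / sqrt (deg W i)"
proof -
  have "(\<Sum>j\<in>UNIV. W i j / (sqrt (deg W i) * sqrt (deg W j)) * (sqrt (deg W j) * v $ j)) =
      (\<Sum>j\<in>UNIV. W i j * v $ j) / sqrt (deg W i)"
    unfolding sum_divide_distrib by (intro sum.cong refl) (simp add: field_simps)
  moreover have "sqrt (deg W i) * v $ i = deg W i * v $ i / sqrt (deg W i)"
    using sqrt_deg_square[of i] by (simp add: field_simps del: sqrt_deg_square)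
  ultimately show ?thesis by (simp add: sym_laplacian_def rescale_def diff_divide_distrib)
qed

lemma sym_laplacian_eigen_iff:
  "sym_laplacian (rescale v) = \<mu> *\<^sub>R rescale v \<longleftrightarrow> v \<in> eigenspace W \<mu>"
proof -
  have "(deg W i * v $ i - s) / sqrt (deg W i) = \<mu> * (sqrt (deg W i) * v $ i) \<longleftrightarrow>
      s = (1 - \<mu>) * deg W i * v $ i" for i s
  proof -
    have "(deg W i * v $ i - s) / sqrt (deg W i) = \<mu> * (sqrt (deg W i) * v $ i) \<longleftrightarrow>
        deg W i * v $ i - s = \<mu> * ((sqrt (deg W i) * sqrt (deg W i)) * v $ i)"
      by (simp add: divide_eq_eq mult_ac del: sqrt_deg_square)
    also have "\<dots> \<longleftrightarrow> s = (1 - \<mu>) * deg W i * v $ i"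
      by (auto simp: left_diff_distrib mult.assoc)
    finally show ?thesis .
  qed
  then show ?thesis
    by (simp add: vec_eq_iff sym_laplacian_rescale eigenspace_iff) (simp add: rescale_def)
qed

lemma dim_eigenspace: "dim {x. sym_laplacian x = \<mu> *\<^sub>R x} = dim (eigenspace W \<mu>)"
proof -
  have "{x. sym_laplacian x = \<mu> *\<^sub>R x} = rescale ` eigenspace W \<mu>"
  proof (intro set_eqI iffI)
    fix x assume x: "x \<in> {x. sym_laplacian x = \<mu> *\<^sub>R x}"
    obtain v where "x = rescale v" using surj_rescale by (rule surjE)
    with x show "x \<in> rescale ` eigenspace W \<mu>" by (simp add: sym_laplacian_eigen_iff)
  qed (auto simp: sym_laplacian_eigen_iff)
  then show ?thesis
    by (simp add: dim_image_eq[OF linear_rescale] inj_on_subset[OF inj_rescale])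
qed

lemma rescale_eq_0_iff: "rescale v = 0 \<longleftrightarrow> v = 0"
  by (auto simp: rescale_def vec_eq_iff)

lemma eigenvalues_eq:
  "{\<mu>. \<exists>v\<in>eigenspace W \<mu>. v \<noteq> 0} = {\<mu>. \<exists>x\<in>{x. sym_laplacian x = \<mu> *\<^sub>R x}. x \<noteq> 0}"
proof (intro Collect_cong iffI)
  fix \<mu> assume "\<exists>v\<in>eigenspace W \<mu>. v \<noteq> 0"
  then obtain v where "v \<in> eigenspace W \<mu>" "v \<noteq> 0" by blast
  then show "\<exists>x\<in>{x. sym_laplacian x = \<mu> *\<^sub>R x}. x \<noteq> 0"
    by (intro bexI[of _ "rescale v"]) (auto simp: sym_laplacian_eigen_iff rescale_eq_0_iff)
next
  fix \<mu> assume "\<exists>x\<in>{x. sym_laplacian x = \<mu> *\<^sub>R x}. x \<noteq> 0"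
  then obtain x where x: "sym_laplacian x = \<mu> *\<^sub>R x" "x \<noteq> 0" by blast
  obtain v where "x = rescale v" using surj_rescale by (rule surjE)
  with x show "\<exists>v\<in>eigenspace W \<mu>. v \<noteq> 0"
    by (intro bexI[of _ v]) (auto simp: sym_laplacian_eigen_iff rescale_eq_0_iff)
qed

section \<open>The sorted list of eigenvalues\<close>

lemma sorted_spectrum: "sorted (laplacian_spectrum W)"
  by (simp add: laplacian_spectrum_def)

lemma finite_eigenvalues: "finite {\<mu>. \<exists>v\<in>eigenspace W \<mu>. v \<noteq> 0}"
  unfolding eigenvalues_eq
  by (rule selfadjoint_sum_dim_eigenspaces(1)[OF linear_sym_laplacian sym_laplacian_selfadjoint])

text \<open>Guarantees that the positions \<open>1\<close> and \<open>CARD('v) - 1\<close> hold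
  actual entries once there are two vertices.\<close>

lemma length_spectrum: "length (laplacian_spectrum W) = CARD('v)"
proof -
  have "length (laplacian_spectrum W) = size (mset (laplacian_spectrum W))" by simp
  also have "\<dots> = (\<Sum>\<mu> | \<exists>v\<in>eigenspace W \<mu>. v \<noteq> 0. dim (eigenspace W \<mu>))"
    by (simp add: laplacian_spectrum_def del: size_mset)
  also have "\<dots> = DIM(real ^ 'v)"
    unfolding eigenvalues_eq dim_eigenspace[symmetric]
    by (rule selfadjoint_sum_dim_eigenspaces(2)[OF linear_sym_laplacian sym_laplacian_selfadjoint])
  finally show ?thesis by simp
qed

lemma count_spectrum_le: "count (mset (laplacian_spectrum W)) \<mu> \<le> dim (eigenspace W \<mu>)"
  using finite_eigenvalues by (simp add: laplacian_spectrum_def count_sum sum.If_cases)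

lemma set_spectrum: "set (laplacian_spectrum W) = {\<mu>. \<exists>v\<in>eigenspace W \<mu>. v \<noteq> 0}"
proof -
  have "eigenspace W \<mu> \<subseteq> {0} \<longleftrightarrow> \<not> (\<exists>v\<in>eigenspace W \<mu>. v \<noteq> 0)" for \<mu> by blast
  then show ?thesis
    using finite_eigenvalues by (auto simp: laplacian_spectrum_def set_mset_sum split: if_splits)
qed

lemma inner_rescale: "rescale v \<bullet> rescale v = sq_norm (($) v)"
proof -
  have "sqrt (deg W i) * v $ i * (sqrt (deg W i) * v $ i) = deg W i * (v $ i)\<^sup>2" for i
  proof -
    have "sqrt (deg W i) * v $ i * (sqrt (deg W i) * v $ i) = (sqrt (deg W i) * sqrt (deg W i)) * (v $ i)\<^sup>2"
      unfolding power2_eq_square by (simp only: mult_ac)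
    then show ?thesis by simp
  qed
  then show ?thesis by (simp add: inner_vec_def rescale_def sq_norm_def)
qed

text \<open>Green's formula; the double sum sees each edge between distinct vertices in both orders,
  hence the division by 2.\<close>

lemma inner_sym_laplacian_rescale:
  "sym_laplacian (rescale v) \<bullet> rescale v = (\<Sum>i\<in>UNIV. \<Sum>j\<in>UNIV. W i j * (v $ i - v $ j)\<^sup>2) / 2"
proof -
  have cancel: "s / sqrt (deg W i) * (sqrt (deg W i) * t) = s * t" for s t i
    by simp
  have "sym_laplacian (rescale v) \<bullet> rescale v =
      (\<Sum>i\<in>UNIV. deg W i * (v $ i)\<^sup>2 - (\<Sum>j\<in>UNIV. W i j * (v $ i * v $ j)))"
    unfolding inner_vec_def sym_laplacian_rescale rescale_nth inner_real_def cancel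
    by (intro sum.cong refl) (simp add: power2_eq_square sum_distrib_left algebra_simps)
  also have "\<dots> = sq_norm (($) v) - (\<Sum>i\<in>UNIV. \<Sum>j\<in>UNIV. W i j * (v $ i * v $ j))"
    by (simp add: sum_subtractf sq_norm_def)
  finally show ?thesis by (simp add: sum_diff_squares)
qed

lemma dirichlet_eigenvector:
  assumes "v \<in> eigenspace W \<mu>"
  shows "(\<Sum>i\<in>UNIV. \<Sum>j\<in>UNIV. W i j * (v $ i - v $ j)\<^sup>2) = 2 * \<mu> * sq_norm (($) v)"
  using assms inner_rescale[of v] inner_sym_laplacian_rescale[of v]
  by (simp add: sym_laplacian_eigen_iff[symmetric])

lemma sq_norm_vec_pos: "v \<noteq> 0 \<Longrightarrow> sq_norm (($) v) > 0"
  using sq_norm_pos[of "($) v"] by (auto simp: vec_eq_iff)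

lemma spectrum_nonneg:
  assumes "\<mu> \<in> set (laplacian_spectrum W)"
  shows "\<mu> \<ge> 0"
proof -
  obtain v where v: "v \<in> eigenspace W \<mu>" "v \<noteq> 0" using assms by (auto simp: set_spectrum)
  have "0 \<le> (\<Sum>i\<in>UNIV. \<Sum>j\<in>UNIV. W i j * (v $ i - v $ j)\<^sup>2)"
    by (intro sum_nonneg mult_nonneg_nonneg nonneg) simp
  then show ?thesis
    using dirichlet_eigenvector[OF v(1)] sq_norm_vec_pos[OF v(2)] by (simp add: zero_le_mult_iff)
qed

lemma eigenvector_orthogonal_const:
  assumes v: "v \<in> eigenspace W \<mu>" and "\<mu> \<noteq> 0"
  shows "(\<Sum>i\<in>UNIV. deg W i * v $ i) = 0"
proof -
  have "(\<Sum>i\<in>UNIV. deg W i * v $ i) = (\<Sum>i\<in>UNIV. \<Sum>j\<in>UNIV. W i j * v $ j)"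
    by (simp add: sum_snd)
  also have "\<dots> = (1 - \<mu>) * (\<Sum>i\<in>UNIV. deg W i * v $ i)"
    using v by (simp add: eigenspace_iff sum_distrib_left mult_ac)
  finally show ?thesis using \<open>\<mu> \<noteq> 0\<close> by (simp add: algebra_simps)
qed

lemma spectrum_le_last:
  assumes "\<mu> \<in> set (laplacian_spectrum W)"
  shows "\<mu> \<le> laplacian_eigenvalue W (CARD('v) - 1)"
proof -
  obtain k where "k < CARD('v)" "laplacian_spectrum W ! k = \<mu>"
    using assms by (auto simp: in_set_conv_nth length_spectrum)
  then show ?thesis
    using sorted_nth_mono[OF sorted_spectrum, of k "CARD('v) - 1"]
    by (simp add: laplacian_eigenvalue_def length_spectrum)
qed

text \<open>The maximum of the Rayleigh quotient is itself an eigenvalue, hence at most the last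
  one.\<close>

lemma rayleigh_le_last:
  "(\<Sum>i\<in>UNIV. \<Sum>j\<in>UNIV. W i j * (f i - f j)\<^sup>2) \<le> 2 * laplacian_eigenvalue W (CARD('v) - 1) * sq_norm f"
proof -
  have "(\<chi> i. 1) \<noteq> (0 :: real ^ 'v)" by (simp add: vec_eq_iff)
  then have "(UNIV :: (real ^ 'v) set) \<noteq> {0}" by blast
  then obtain x m where x: "norm x = 1" "sym_laplacian x = m *\<^sub>R x"
    and max: "\<And>y. sym_laplacian y \<bullet> y \<le> m * (y \<bullet> y)"
    using selfadjoint_maximal_eigenvector[OF linear_sym_laplacian sym_laplacian_selfadjoint, of UNIV]
    by auto
  have "m \<in> set (laplacian_spectrum W)"
    unfolding set_spectrum eigenvalues_eq using x by force
  then have m: "m \<le> laplacian_eigenvalue W (CARD('v) - 1)" by (rule spectrum_le_last)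
  define v where "v = (\<chi> i. f i)"
  have f: "f = ($) v" by (simp add: v_def fun_eq_iff)
  have "sym_laplacian (rescale v) \<bullet> rescale v \<le> m * sq_norm f"
    using max[of "rescale v"] by (simp add: inner_rescale f)
  also have "\<dots> \<le> laplacian_eigenvalue W (CARD('v) - 1) * sq_norm f"
    using m deg_pos by (intro mult_right_mono) (auto simp: sq_norm_def less_imp_le intro!: sum_nonneg)
  finally show ?thesis by (simp add: inner_sym_laplacian_rescale f)
qed

end

section \<open>Eigenvalue estimates on connected graphs\<close>

context connected_weight
begin

text \<open>Vanishing energy forces equal values across every edge, so no edge leaves the set where
  \<open>v\<close> agrees with its value at a fixed vertex.\<close>

lemma eigenspace_0: "eigenspace W 0 = span {\<chi> i. 1}"
proof
  have "(\<chi> i. 1) \<in> eigenspace W 0"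
    by (simp add: eigenspace_iff deg_def)
  moreover have "subspace (eigenspace W 0)"
    by (simp add: subspace_def eigenspace_iff distrib_left sum.distrib mult.left_commute[of _ "_ :: real"]
        flip: sum_distrib_left)
  ultimately show "span {\<chi> i. 1} \<subseteq> eigenspace W 0"
    by (intro span_minimal) auto
next
  show "eigenspace W 0 \<subseteq> span {\<chi> i. 1}"
  proof
    fix v assume v: "v \<in> eigenspace W 0"
    have "(\<Sum>i\<in>UNIV. \<Sum>j\<in>UNIV. W i j * (v $ i - v $ j)\<^sup>2) = 0"
      using dirichlet_eigenvector[OF v] by simp
    then have zero: "W i j * (v $ i - v $ j)\<^sup>2 = 0" for i j
      by (simp add: sum_nonneg_eq_0_iff nonneg sum_nonneg)
    define k :: 'v where "k = undefined"
    have "- {i. v $ i = v $ k} = {}"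
    proof (rule ccontr)
      assume "- {i. v $ i = v $ k} \<noteq> {}"
      moreover have "k \<in> {i. v $ i = v $ k}" by simp
      ultimately obtain i j where "v $ i = v $ k" "v $ j \<noteq> v $ k" "W i j > 0"
        using crossing[of "{i. v $ i = v $ k}"] by auto
      then show False using zero[of i j] by simp
    qed
    then have "v = v $ k *\<^sub>R (\<chi> i. 1)" by (auto simp: vec_eq_iff)
    then show "v \<in> span {\<chi> i. 1}" by (metis span_base span_scale singletonI)
  qed
qed

lemma second_eigenvalue:
  shows "laplacian_eigenvalue W 1 > 0"
    and "\<And>\<mu>. \<mu> \<in> set (laplacian_spectrum W) \<Longrightarrow> \<mu> > 0 \<Longrightarrow> laplacian_eigenvalue W 1 \<le> \<mu>"
proof -
  have "(\<chi> i. 1) \<noteq> (0 :: real ^ 'v)" by (simp add: vec_eq_iff)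
  then have zero: "0 \<in> set (laplacian_spectrum W)"
    unfolding set_spectrum eigenspace_0 mem_Collect_eq by (metis span_base singletonI)
  have "count (mset (laplacian_spectrum W)) 0 \<le> 1"
    using count_spectrum_le[of 0] dim_le_card[of "eigenspace W 0" "{\<chi> i. 1}"]
    by (simp add: eigenspace_0)
  note * = sorted_second[OF sorted_spectrum _ spectrum_nonneg zero this]
  show "laplacian_eigenvalue W 1 > 0"
    unfolding laplacian_eigenvalue_def using card_ge_2 by (intro *) (simp_all add: length_spectrum)
  show "laplacian_eigenvalue W 1 \<le> \<mu>" if "\<mu> \<in> set (laplacian_spectrum W)" "\<mu> > 0" for \<mu>
    unfolding laplacian_eigenvalue_def using card_ge_2 that by (intro *) (simp_all add: length_spectrum)
qed

text \<open>Maximizing for \<open>- sym_laplacian\<close> on the orthogonal complement of the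
  constants minimizes the Rayleigh quotient there. The minimum is a positive eigenvalue, hence at
  least the one at position 1.\<close>

lemma rayleigh_ge_second:
  assumes orth: "(\<Sum>i\<in>UNIV. deg W i * f i) = 0"
  shows "2 * laplacian_eigenvalue W 1 * sq_norm f \<le> (\<Sum>i\<in>UNIV. \<Sum>j\<in>UNIV. W i j * (f i - f j)\<^sup>2)"
proof -
  define v where "v = (\<chi> i. f i)"
  have f: "f = ($) v" by (simp add: v_def fun_eq_iff)
  define one :: "real ^ 'v" where "one = (\<chi> i. 1)"
  have T1: "sym_laplacian (rescale one) = 0"
    using sym_laplacian_eigen_iff[of one 0] by (simp add: eigenspace_0 one_def span_base)
  have inner1: "rescale one \<bullet> rescale u = (\<Sum>i\<in>UNIV. deg W i * u $ i)" for u
    by (simp add: inner_vec_def rescale_def one_def flip: mult.assoc)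
  define S where "S = {y. rescale one \<bullet> y = 0}"
  have v: "rescale v \<in> S" using orth by (simp add: S_def inner1 f)
  show ?thesis
  proof (cases "v = 0")
    case True
    then show ?thesis by (simp add: f sq_norm_def)
  next
    case False
    have "linear (\<lambda>x. - sym_laplacian x)"
      using linear_sym_laplacian by (rule linear_compose_neg)
    moreover have "- sym_laplacian x \<bullet> y = x \<bullet> - sym_laplacian y" for x y
      by (simp add: sym_laplacian_selfadjoint)
    moreover have "subspace S" by (simp add: S_def subspace_hyperplane)
    moreover have "(\<lambda>x. - sym_laplacian x) ` S \<subseteq> S"
      by (auto simp: S_def T1 simp flip: sym_laplacian_selfadjoint)
    moreover have "S \<noteq> {0}" using v False rescale_eq_0_iff[of v] by auto
    ultimately obtain x m where x: "x \<in> S" "norm x = 1" "- sym_laplacian x = m *\<^sub>R x"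
      and max: "\<And>y. y \<in> S \<Longrightarrow> - sym_laplacian y \<bullet> y \<le> m * (y \<bullet> y)"
      using selfadjoint_maximal_eigenvector[of "\<lambda>x. - sym_laplacian x" S] by blast
    have "x \<noteq> 0" using x by auto
    have Tx: "sym_laplacian x = (- m) *\<^sub>R x" using x(3) by (metis minus_minus scaleR_minus_left)
    have spec: "- m \<in> set (laplacian_spectrum W)"
      unfolding set_spectrum eigenvalues_eq using Tx \<open>x \<noteq> 0\<close> by auto
    \<comment> \<open>Otherwise \<open>x\<close> would lie both on the line of the rescaled
      constants and in its orthogonal complement.\<close>
    have "m \<noteq> 0"
    proof
      assume "m = 0"
      obtain u where u: "x = rescale u" using surj_rescale by (rule surjE)
      have "u \<in> eigenspace W 0" using Tx \<open>m = 0\<close> u sym_laplacian_eigen_iff[of u 0] by simp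
      then obtain c where "u = c *\<^sub>R one" unfolding eigenspace_0 one_def by (auto simp: span_singleton)
      then have "x = c *\<^sub>R rescale one" using u by (simp add: linear_scale[OF linear_rescale])
      then have "x \<bullet> x = 0" using x(1) by (simp add: S_def)
      then show False using \<open>x \<noteq> 0\<close> by simp
    qed
    then have "- m > 0" using spectrum_nonneg[OF spec] by simp
    then have m: "laplacian_eigenvalue W 1 \<le> - m" using second_eigenvalue(2)[OF spec] by simp
    have "laplacian_eigenvalue W 1 * sq_norm f \<le> - m * sq_norm f"
      using m deg_pos by (intro mult_right_mono) (auto simp: sq_norm_def less_imp_le intro!: sum_nonneg)
    also have "\<dots> \<le> sym_laplacian (rescale v) \<bullet> rescale v"
      using max[OF v] by (simp add: inner_rescale f)
    finally show ?thesis by (simp add: inner_sym_laplacian_rescale f)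
  qed
qed

text \<open>A two-valued function adapted to an optimal cut is inserted into the Rayleigh
  quotient.\<close>

lemma second_le_cheeger: "laplacian_eigenvalue W 1 \<le> 2 * cheeger W 1"
proof -
  obtain A where A: "A \<noteq> {}" "- A \<noteq> {}"
    "cheeger W 1 * min (vol W A) (vol W (- A)) = edge_weight W 1 A (- A)"
    by (rule cheeger_attained)
  define a where "a = vol W A"
  define b where "b = vol W (- A)"
  define e where "e = cut A (- A)"
  have e: "edge_weight W 1 A (- A) = e"
    by (simp add: e_def edge_weight_def cut_def neighborhood_weight_1)
  have ab: "a > 0" "b > 0" using A vol_pos by (auto simp: a_def b_def)
  \<comment> \<open>The values make the weighted sum \<open>b * a - a * b\<close> vanish, and
    \<open>f\<close> jumps by \<open>a + b\<close> across the cut.\<close>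
  define f where "f i = b * indicator A i - a * indicator (- A) i" for i
  have sum_ind: "(\<Sum>i\<in>UNIV. deg W i * indicator B i) = vol W B" for B
    by (simp add: vol_def)
  have "(\<Sum>i\<in>UNIV. deg W i * f i) =
      b * (\<Sum>i\<in>UNIV. deg W i * indicator A i) - a * (\<Sum>i\<in>UNIV. deg W i * indicator (- A) i)"
    unfolding f_def by (simp only: right_diff_distrib sum_subtractf sum_distrib_left mult.left_commute)
  then have orth: "(\<Sum>i\<in>UNIV. deg W i * f i) = 0"
    unfolding sum_ind by (simp add: a_def b_def)
  have "deg W i * (f i)\<^sup>2 = b\<^sup>2 * (deg W i * indicator A i) + a\<^sup>2 * (deg W i * indicator (- A) i)" for i
    by (simp add: f_def indicator_def)
  then have "sq_norm f = b\<^sup>2 * (\<Sum>i\<in>UNIV. deg W i * indicator A i) + a\<^sup>2 * (\<Sum>i\<in>UNIV. deg W i * indicator (- A) i)"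
    by (simp only: sq_norm_def sum.distrib sum_distrib_left)
  then have norm: "sq_norm f = b\<^sup>2 * a + a\<^sup>2 * b"
    unfolding sum_ind by (simp add: a_def b_def)
  have "W i j * (f i - f j)\<^sup>2 = (a + b)\<^sup>2 * (W i j * (indicator A i * indicator (- A) j))
      + (a + b)\<^sup>2 * (W i j * (indicator (- A) i * indicator A j))" for i j
    by (cases "i \<in> A"; cases "j \<in> A") (simp_all add: f_def power2_eq_square algebra_simps)
  then have "(\<Sum>i\<in>UNIV. \<Sum>j\<in>UNIV. W i j * (f i - f j)\<^sup>2) = (a + b)\<^sup>2 * cut A (- A) + (a + b)\<^sup>2 * cut (- A) A"
    by (simp only: sum.distrib cut_indicator flip: sum_distrib_left)
  then have "2 * laplacian_eigenvalue W 1 * sq_norm f \<le> 2 * (a + b)\<^sup>2 * e"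
    using rayleigh_ge_second[OF orth] by (simp add: e_def cut_commute[of "- A"] mult_ac)
  then have "(a + b) * (laplacian_eigenvalue W 1 * (a * b)) \<le> (a + b) * ((a + b) * e)"
    unfolding norm by (simp add: power2_eq_square algebra_simps)
  then have "laplacian_eigenvalue W 1 * (a * b) \<le> (a + b) * e"
    using ab by simp
  also have "e = cheeger W 1 * min a b" unfolding a_def b_def using A(3) e by simp
  also have "(a + b) * (cheeger W 1 * min a b) = cheeger W 1 * ((a + b) * min a b)" by simp
  \<comment> \<open>\<open>a * b\<close> is the minimum times the maximum, and \<open>a + b\<close>
    is at most twice the maximum.\<close>
  also have "(a + b) * min a b \<le> 2 * (a * b)"
    using ab by (cases "a \<le> b") (auto simp: min_def algebra_simps)
  then have "cheeger W 1 * ((a + b) * min a b) \<le> cheeger W 1 * (2 * (a * b))"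
    using cheeger_1_pos by (intro mult_left_mono) auto
  finally have "laplacian_eigenvalue W 1 * (a * b) \<le> (2 * cheeger W 1) * (a * b)" by simp
  then show ?thesis using ab by (simp add: mult_le_cancel_right)
qed

text \<open>The test function is 1 on \<open>A\<close>, -1 on \<open>B\<close> and 0 elsewhere, for
  an optimal pair.\<close>

lemma dual_cheeger_le_last: "2 * dual_cheeger W 1 \<le> laplacian_eigenvalue W (CARD('v) - 1)"
proof -
  obtain A B where A: "A \<noteq> {}" "B \<noteq> {}" "A \<inter> B = {}"
    "2 * edge_weight W 1 A B = dual_cheeger W 1 * (vol W A + vol W B)"
    by (rule dual_cheeger_attained)
  define f :: "'v \<Rightarrow> real" where "f i = indicator A i - indicator B i" for i
  have e: "edge_weight W 1 A B = cut A B"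
    by (simp add: edge_weight_def cut_def neighborhood_weight_1)
  have pos: "vol W A + vol W B > 0" using vol_pos[OF A(1)] vol_pos[OF A(2)] by simp
  have "deg W i * (f i)\<^sup>2 = deg W i * indicator A i + deg W i * indicator B i" for i
    using A(3) by (cases "i \<in> A"; cases "i \<in> B") (auto simp: f_def)
  then have norm: "sq_norm f = vol W A + vol W B"
    by (simp add: sq_norm_def sum.distrib vol_def)
  \<comment> \<open>Edges between \<open>A\<close> and \<open>B\<close> have squared difference 4;
    those leading out of the union contribute a nonnegative rest that is dropped.\<close>
  have "4 * (W i j * (indicator A i * indicator B j)) + 4 * (W i j * (indicator B i * indicator A j))
      \<le> W i j * (f i - f j)\<^sup>2" for i j
    using A(3) nonneg[of i j]
    by (cases "i \<in> A"; cases "i \<in> B"; cases "j \<in> A"; cases "j \<in> B") (auto simp: f_def)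
  then have "(\<Sum>i\<in>UNIV. \<Sum>j\<in>UNIV. 4 * (W i j * (indicator A i * indicator B j)) + 4 * (W i j * (indicator B i * indicator A j)))
      \<le> (\<Sum>i\<in>UNIV. \<Sum>j\<in>UNIV. W i j * (f i - f j)\<^sup>2)"
    by (intro sum_mono)
  also have "(\<Sum>i\<in>UNIV. \<Sum>j\<in>UNIV. 4 * (W i j * (indicator A i * indicator B j)) + 4 * (W i j * (indicator B i * indicator A j)))
     = 4 * cut A B + 4 * cut B A"
    by (simp only: sum.distrib cut_indicator flip: sum_distrib_left)
  also have "(\<Sum>i\<in>UNIV. \<Sum>j\<in>UNIV. W i j * (f i - f j)\<^sup>2)
      \<le> 2 * laplacian_eigenvalue W (CARD('v) - 1) * (vol W A + vol W B)"
    using rayleigh_le_last[of f] unfolding norm .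
  finally have "2 * (2 * edge_weight W 1 A B) \<le> laplacian_eigenvalue W (CARD('v) - 1) * (vol W A + vol W B)"
    unfolding e by (simp add: cut_commute[of B A])
  then have "(2 * dual_cheeger W 1) * (vol W A + vol W B) \<le> laplacian_eigenvalue W (CARD('v) - 1) * (vol W A + vol W B)"
    unfolding A(4) by simp
  then show ?thesis using pos by (rule mult_right_le_imp_le)
qed

text \<open>The same eigenvector serves the neighborhood graph with the eigenvalue
  \<open>(1 - \<mu>) ^ l\<close>, whose sign decides which Cheeger inequality applies. Where the
  sign is wrong, the left side is negative and the root is not.\<close>

lemma eigenvalue_root_bounds:
  assumes spec: "\<mu> \<in> set (laplacian_spectrum W)" "\<mu> > 0" and l: "l > 0"
  shows "1 - \<mu> \<le> (1 - (cheeger W l)\<^sup>2) powr (1 / (2 * real l))"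
    and "even l \<Longrightarrow> \<mu> - 1 \<le> (1 - (cheeger W l)\<^sup>2) powr (1 / (2 * real l))"
    and "odd l \<Longrightarrow> \<mu> - 1 \<le> (1 - (1 - dual_cheeger W l)\<^sup>2) powr (1 / (2 * real l))"
proof -
  interpret N: weight_matrix "neighborhood_weight W l" by (rule weight_matrix_neighborhood[OF l])
  obtain v where v: "v \<in> eigenspace W \<mu>" "v \<noteq> 0" using spec by (auto simp: set_spectrum)
  obtain k where k: "v $ k \<noteq> 0" using v by (auto simp: vec_eq_iff)
  have degN: "deg (neighborhood_weight W l) = deg W"
    by (simp add: fun_eq_iff neighborhood_weight_eq_walk_weight[OF l] deg_walk_weight)
  have volN: "vol (neighborhood_weight W l) = vol W" by (rule vol_neighborhood[OF l])
  have cutN: "N.cut = edge_weight W l" by (rule edge_weight_eq_cut[OF l, symmetric])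
  have eig: "(\<Sum>j\<in>UNIV. neighborhood_weight W l i j * v $ j) = (1 - \<mu>) ^ l * deg (neighborhood_weight W l) i * v $ i" for i
    unfolding neighborhood_weight_eq_walk_weight[OF l] deg_walk_weight
    using v(1) by (intro walk_weight_eigen) (simp add: eigenspace_iff)
  have orth: "(\<Sum>i\<in>UNIV. deg (neighborhood_weight W l) i * v $ i) = 0"
    unfolding degN using eigenvector_orthogonal_const[OF v(1)] spec by simp
  \<comment> \<open>Covers \<open>1 - \<mu>\<close> and \<open>\<mu> - 1\<close> alike, because the
    exponent \<open>2 * l\<close> is even.\<close>
  have root: "x \<le> y powr (1 / (2 * real l))" if "\<bar>x\<bar> = \<bar>1 - \<mu>\<bar>" "z\<^sup>2 \<le> 1 - ((1 - \<mu>) ^ l)\<^sup>2" "y = 1 - z\<^sup>2" for x y z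
  proof -
    have "x ^ (2 * l) = (1 - \<mu>) ^ (2 * l)"
      using that(1) by (metis power_even_abs even_mult_iff even_numeral)
    then have "x ^ (2 * l) \<le> y" using that(2,3) power_even_eq[of "1 - \<mu>" l] by linarith
    moreover have "0 \<le> y" using that zero_le_power2[of "(1 - \<mu>) ^ l"] by linarith
    ultimately show ?thesis using le_powr_inverse[of x "2 * l" y] l by simp
  qed
  have h: "(cheeger W l)\<^sup>2 \<le> 1 - ((1 - \<mu>) ^ l)\<^sup>2" if "(1 - \<mu>) ^ l \<ge> 0"
    using N.eigenvalue_cheeger[OF eig k orth that cheeger_bounds(1)[OF l]] cheeger_le
    unfolding volN cutN by blast
  show "1 - \<mu> \<le> (1 - (cheeger W l)\<^sup>2) powr (1 / (2 * real l))"
  proof (cases "1 - \<mu> \<ge> 0")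
    case True
    then show ?thesis by (intro root[OF _ h]) auto
  next
    case False
    then show ?thesis using powr_ge_zero[of "1 - (cheeger W l)\<^sup>2" "1 / (2 * real l)"] by linarith
  qed
  show "\<mu> - 1 \<le> (1 - (cheeger W l)\<^sup>2) powr (1 / (2 * real l))" if "even l"
    using that by (intro root[OF _ h]) auto
  show "\<mu> - 1 \<le> (1 - (1 - dual_cheeger W l)\<^sup>2) powr (1 / (2 * real l))" if "odd l"
  proof (cases "1 - \<mu> \<le> 0")
    case True
    then have neg: "(1 - \<mu>) ^ l \<le> 0" using that l by (simp add: power_le_zero_eq)
    have "0 \<le> 1 - dual_cheeger W l" "1 - dual_cheeger W l \<le> 1"
      using dual_cheeger_bounds[OF l] by simp_all
    from N.eigenvalue_dual_cheeger[OF eig k neg this]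
    have "(1 - dual_cheeger W l)\<^sup>2 \<le> 1 - ((1 - \<mu>) ^ l)\<^sup>2"
      unfolding volN cutN using dual_cheeger_ge by simp
    then show ?thesis by (intro root) auto
  next
    case False
    then show ?thesis using powr_ge_zero[of "1 - (1 - dual_cheeger W l)\<^sup>2" "1 / (2 * real l)"] by linarith
  qed
qed

text \<open>\<open>LEAST\<close> on the reals says nothing unless a minimum exists, so attainment
  must be shown before the bound can be used.\<close>

lemma even_upper_bound_attained:
  obtains l where "l > 0" "even l"
    "even_upper_bound W = 1 + (1 - (cheeger W l)\<^sup>2) powr (1 / (2 * real l))"
proof -
  obtain c where "c < 1" "\<And>l. l > 0 \<Longrightarrow> even l \<Longrightarrow> cheeger W l \<le> c"
    by (rule cheeger_even_le) blast
  then have "(\<exists>l\<in>{l. l > 0 \<and> even l}. cheeger W l = 1) \<or> (\<exists>c<1. \<forall>l\<in>{l. l > 0 \<and> even l}. cheeger W l \<le> c)"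
    by auto
  then have "\<exists>l\<in>{l. l > 0 \<and> even l}. \<forall>k\<in>{l. l > 0 \<and> even l}.
      (1 - (cheeger W l)\<^sup>2) powr (1 / (2 * real l)) \<le> (1 - (cheeger W k)\<^sup>2) powr (1 / (2 * real k))"
    by (rule least_root_attained[of 2, rotated 4]) (auto simp: cheeger_bounds)
  then obtain l where l: "l > 0" "even l"
    and min: "\<And>k. k > 0 \<Longrightarrow> even k \<Longrightarrow>
      (1 - (cheeger W l)\<^sup>2) powr (1 / (2 * real l)) \<le> (1 - (cheeger W k)\<^sup>2) powr (1 / (2 * real k))" by blast
  have "even_upper_bound W = 1 + (1 - (cheeger W l)\<^sup>2) powr (1 / (2 * real l))"
    unfolding even_upper_bound_def
    by (rule Least_equality) (use l min in auto)
  with l show thesis by (rule that)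
qed

lemma odd_upper_bound_attained:
  obtains l where "l > 0" "odd l"
    "odd_upper_bound W = 1 + (1 - (1 - dual_cheeger W l)\<^sup>2) powr (1 / (2 * real l))"
proof -
  obtain c where "c < 1" "\<And>l. l > 0 \<Longrightarrow> odd l \<Longrightarrow> 1 - dual_cheeger W l \<le> c"
    by (rule dual_cheeger_odd_ge) blast
  then have "(\<exists>l\<in>{l. l > 0 \<and> odd l}. 1 - dual_cheeger W l = 1) \<or> (\<exists>c<1. \<forall>l\<in>{l. l > 0 \<and> odd l}. 1 - dual_cheeger W l \<le> c)"
    by auto
  then have "\<exists>l\<in>{l. l > 0 \<and> odd l}. \<forall>k\<in>{l. l > 0 \<and> odd l}.
      (1 - (1 - dual_cheeger W l)\<^sup>2) powr (1 / (2 * real l)) \<le> (1 - (1 - dual_cheeger W k)\<^sup>2) powr (1 / (2 * real k))"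
    by (rule least_root_attained[of 1, rotated 4]) (auto simp: dual_cheeger_bounds)
  then obtain l where l: "l > 0" "odd l"
    and min: "\<And>k. k > 0 \<Longrightarrow> odd k \<Longrightarrow>
      (1 - (1 - dual_cheeger W l)\<^sup>2) powr (1 / (2 * real l)) \<le> (1 - (1 - dual_cheeger W k)\<^sup>2) powr (1 / (2 * real k))" by blast
  have "odd_upper_bound W = 1 + (1 - (1 - dual_cheeger W l)\<^sup>2) powr (1 / (2 * real l))"
    unfolding odd_upper_bound_def
    by (rule Least_equality) (use l min in auto)
  with l show thesis by (rule that)
qed

text \<open>The greatest value occurs where the root is least; positivity is recorded because this
  bound becomes a denominator.\<close>

lemma lower_bound_attained:
  obtains l where "l > 0" "lower_bound W = 1 - (1 - (cheeger W l)\<^sup>2) powr (1 / (2 * real l))"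
    "lower_bound W > 0"
proof -
  have "(\<exists>l\<in>{l. l > 0}. cheeger W l = 1) \<or> (\<exists>c<1. \<forall>l\<in>{l. l > 0}. cheeger W l \<le> c)"
  proof (cases "cheeger W 1 = 1")
    case True
    then show ?thesis by (intro disjI1 bexI[of _ 1]) auto
  next
    case False
    then obtain c where "c < 1" "\<And>l. l > 0 \<Longrightarrow> cheeger W l \<le> c"
      by (rule cheeger_bounded_away) blast
    then show ?thesis by auto
  qed
  then have "\<exists>l\<in>{l. l > 0}. \<forall>k\<in>{l. l > 0}.
      (1 - (cheeger W l)\<^sup>2) powr (1 / (2 * real l)) \<le> (1 - (cheeger W k)\<^sup>2) powr (1 / (2 * real k))"
    by (rule least_root_attained[of 1, rotated 4]) (auto simp: cheeger_bounds)
  then obtain l where l: "l > 0"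
    and min: "\<And>k. k > 0 \<Longrightarrow>
      (1 - (cheeger W l)\<^sup>2) powr (1 / (2 * real l)) \<le> (1 - (cheeger W k)\<^sup>2) powr (1 / (2 * real k))" by blast
  have eq: "lower_bound W = 1 - (1 - (cheeger W l)\<^sup>2) powr (1 / (2 * real l))"
    unfolding lower_bound_def
    by (rule Greatest_equality) (use l min in auto)
  \<comment> \<open>Length 1 already gives a positive value, as the Cheeger constant of a connected
    graph is positive.\<close>
  have "(1 - (cheeger W 1)\<^sup>2) powr (1 / (2 * real 1)) < 1 powr (1 / (2 * real 1))"
    using cheeger_1_pos cheeger_bounds(2)[of 1]
    by (intro powr_less_mono2) (auto simp: abs_square_le_1)
  then have "lower_bound W > 0" using min[of 1] by (simp add: eq)
  with l eq show thesis by (rule that)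
qed

lemma eigenvalue_ratio_bounds:
  "dual_cheeger W 1 / cheeger W 1
     \<le> laplacian_eigenvalue W (CARD('v) - 1) / laplacian_eigenvalue W 1"
  "laplacian_eigenvalue W (CARD('v) - 1) / laplacian_eigenvalue W 1
     \<le> min (even_upper_bound W) (odd_upper_bound W) / lower_bound W"
proof -
  define \<mu>\<^sub>1 where "\<mu>\<^sub>1 = laplacian_eigenvalue W 1"
  define \<mu>\<^sub>N where "\<mu>\<^sub>N = laplacian_eigenvalue W (CARD('v) - 1)"
  have spec: "\<mu>\<^sub>1 \<in> set (laplacian_spectrum W)" "\<mu>\<^sub>N \<in> set (laplacian_spectrum W)"
    unfolding \<mu>\<^sub>1_def \<mu>\<^sub>N_def laplacian_eigenvalue_def using card_ge_2
    by (auto intro!: nth_mem simp: length_spectrum)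
  have pos: "\<mu>\<^sub>1 > 0" using second_eigenvalue(1) by (simp add: \<mu>\<^sub>1_def)
  then have posN: "\<mu>\<^sub>N > 0" using spectrum_le_last[OF spec(1)] by (simp add: \<mu>\<^sub>N_def)
  \<comment> \<open>The factors 2 of the two test function bounds cancel in the quotient.\<close>
  have "(2 * dual_cheeger W 1) / (2 * cheeger W 1) \<le> \<mu>\<^sub>N / \<mu>\<^sub>1"
    using dual_cheeger_le_last second_le_cheeger pos posN
    by (intro frac_le) (simp_all add: \<mu>\<^sub>1_def \<mu>\<^sub>N_def)
  then show "dual_cheeger W 1 / cheeger W 1
     \<le> laplacian_eigenvalue W (CARD('v) - 1) / laplacian_eigenvalue W 1"
    by (simp add: \<mu>\<^sub>1_def \<mu>\<^sub>N_def)
  obtain k where k: "k > 0" "even k"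
    "even_upper_bound W = 1 + (1 - (cheeger W k)\<^sup>2) powr (1 / (2 * real k))"
    by (rule even_upper_bound_attained)
  obtain m where m: "m > 0" "odd m"
    "odd_upper_bound W = 1 + (1 - (1 - dual_cheeger W m)\<^sup>2) powr (1 / (2 * real m))"
    by (rule odd_upper_bound_attained)
  obtain l where l: "l > 0" "lower_bound W = 1 - (1 - (cheeger W l)\<^sup>2) powr (1 / (2 * real l))"
    "lower_bound W > 0"
    by (rule lower_bound_attained)
  have "\<mu>\<^sub>N \<le> even_upper_bound W" "\<mu>\<^sub>N \<le> odd_upper_bound W"
    using eigenvalue_root_bounds(2)[OF spec(2) posN k(1,2)] eigenvalue_root_bounds(3)[OF spec(2) posN m(1,2)]
    unfolding k(3) m(3) by linarith+
  moreover have "lower_bound W \<le> \<mu>\<^sub>1"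
    using eigenvalue_root_bounds(1)[OF spec(1) pos l(1)] unfolding l(2) by linarith
  ultimately have "\<mu>\<^sub>N / \<mu>\<^sub>1 \<le> min (even_upper_bound W) (odd_upper_bound W) / lower_bound W"
    using l(3) posN by (intro frac_le) auto
  then show "laplacian_eigenvalue W (CARD('v) - 1) / laplacian_eigenvalue W 1
     \<le> min (even_upper_bound W) (odd_upper_bound W) / lower_bound W"
    by (simp add: \<mu>\<^sub>1_def \<mu>\<^sub>N_def)
qed

end

text \<open>If no edge left \<open>A\<close>, a path starting in \<open>A\<close> could never reach
  its complement.\<close>

lemma crossing_edge:
  fixes adj :: "'v \<Rightarrow> 'v \<Rightarrow> bool"
  assumes "weighted_graph adj w" "connected_graph adj" "A \<noteq> {}" "- A \<noteq> {}"
  shows "\<exists>i\<in>A. \<exists>j\<in>- A. w i j > 0"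
proof (rule ccontr)
  assume no: "\<not> ?thesis"
  obtain a b where ab: "a \<in> A" "b \<in> - A" using assms by blast
  have "adj\<^sup>*\<^sup>* a b" using assms(2) by (simp add: connected_graph_def)
  then have "b \<in> A"
  proof (induction rule: rtranclp_induct)
    case (step x y)
    then have "w x y > 0" using assms(1) by (simp add: weighted_graph_def)
    then show ?case using no step.IH by blast
  qed (fact ab)
  then show False using ab by simp
qed

lemma connected_weight_graph:
  fixes adj :: "'v::finite \<Rightarrow> 'v \<Rightarrow> bool"
  assumes graph: "weighted_graph adj w" "connected_graph adj" "CARD('v) \<ge> 2"
  shows "connected_weight w"
proof
  show sym: "w i j = w j i" for i j
    using graph(1) unfolding weighted_graph_def by blast
  show nonneg: "w i j \<ge> 0" for i j
    using graph(1) unfolding weighted_graph_def by (metis less_imp_le order_refl)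
  show "deg w i > 0" for i
  proof -
    \<comment> \<open>With a second vertex \<open>{i}\<close> is a proper cut, and an edge crossing
      it makes the degree positive.\<close>
    have "- {i} \<noteq> {}"
    proof
      assume "- {i} = {}"
      then have "UNIV = {i}" by blast
      then have "CARD('v) = card {i}" by (rule arg_cong)
      then show False using graph(3) by simp
    qed
    then obtain j where "w i j > 0" using crossing_edge[OF graph(1,2), of "{i}"] by blast
    then show ?thesis unfolding deg_def by (intro sum_pos2[of _ j]) (auto simp: nonneg)
  qed
qed (use graph crossing_edge[OF graph(1,2)] in auto)

theorem corollary10p1:
  fixes adj :: "'v::finite \<Rightarrow> 'v \<Rightarrow> bool"
    and w :: "'v \<Rightarrow> 'v \<Rightarrow> real"
  assumes "weighted_graph adj w"
    and "connected_graph adj"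
    and "CARD('v) \<ge> 2"
  shows "dual_cheeger w 1 / cheeger w 1
           \<le> laplacian_eigenvalue w (CARD('v) - 1) / laplacian_eigenvalue w 1
       \<and> laplacian_eigenvalue w (CARD('v) - 1) / laplacian_eigenvalue w 1
           \<le> min (even_upper_bound w) (odd_upper_bound w) / lower_bound w"
  using connected_weight.eigenvalue_ratio_bounds[OF connected_weight_graph[OF assms]] by simp

end
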